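(* There exists a classical abstract Swiss cheese $\mathbf{A}=((a_n,r_n))_{n=0}^\infty$ such that $R(X_{\mathbf{A}})$ is not regular and does not admit any non-trivial Jensen measures.
   Context: For $a\in\mathbb{C}$ and $r>0$, $\mathrm{B}(a,r)$ and $\bar{\mathrm{B}}(a,r)$ denote the open and closed discs with centre $a$ and radius $r$; also $\mathrm{B}(a,0)=\emptyset$ and $\bar{\mathrm{B}}(a,0)=\{a\}$. An abstract Swiss cheese is a sequence $\mathbf{A}=((a_n,r_n))_{n=0}^\infty$ of elements of $\mathbb{C}\times[0,\infty)$. Set $X_{\mathbf{A}}=\bar{\mathrm{B}}(a_0,r_0)\setminus\bigcup_{n=1}^\infty \mathrm{B}(a_n,r_n)$ and $\rho(\mathbf{A})=\sum_{n=1}^\infty r_n$. $\mathbf{A}$ is classical if $\rho(\mathbf{A})<\infty$, $r_0>0$, and for all $k\geq 1$ with $r_k>0$: (1) $\bar{\mathrm{B}}(a_k,r_k)\subseteq \mathrm{B}(a_0,r_0)$; (2) whenever $\ell\geq 1$ with $r_\ell>0$ and $\ell\neq k$, $\bar{\mathrm{B}}(a_k,r_k)\cap\bar{\mathrm{B}}(a_\ell,r_\ell)=\emptyset$. For a non-empty compact set $X\subseteq\mathbb{C}$, $R(X)$ is the uniform closure in $C(X)$ of the set of restrictions to $X$ of rational functions with no poles on $X$. Every character of $R(X)$ is an evaluation $\varepsilon_x: f\mapsto f(x)$ for some $x\in X$; hence $R(X)$ is regular if and only if it is regular on $X$, i.e. for each closed set $E\subseteq X$ and each $x\in X\setminus E$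 there exists $f\in R(X)$ with $f(x)=1$ and $f(E)\subseteq\{0\}$. A Jensen measure for $\varepsilon_x$ (with respect to $R(X)$) is a (Borel) probability measure $\mu$ on $X$ such that $\log|f(x)|\leq\int_X\log|f|\,d\mu$ for all $f\in R(X)$, with the convention $\log 0=-\infty$. Such a $\mu$ is trivial if $\mu=\delta_x$, the point mass at $x$. $R(X)$ admits no non-trivial Jensen measures if, for every $x\in X$, the only Jensen measure for $\varepsilon_x$ is $\delta_x$. *)

theory Defs
  imports "HOL-Probability.Probability" "HOL-Computational_Algebra.Polynomial"
begin

text \<open>The library conventions \<^prop>\<open>ball a 0 = {}\<close> and \<^prop>\<open>cball a 0 = {a}\<close> for degenerate
  discs are the ones used for Swiss cheeses.\<close>

definition abstract_swiss_cheese :: "(nat \<Rightarrow> complex \<times> real) \<Rightarrow> bool" where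
  "abstract_swiss_cheese A \<longleftrightarrow> (\<forall>n. snd (A n) \<ge> 0)"

definition swiss_cheese_set :: "(nat \<Rightarrow> complex \<times> real) \<Rightarrow> complex set" where
  "swiss_cheese_set A =
     cball (fst (A 0)) (snd (A 0)) - (\<Union>n\<in>{1..}. ball (fst (A n)) (snd (A n)))"

text \<open>The radius sum is taken in \<^typ>\<open>ennreal\<close>, so that it can be infinite.\<close>

definition radius_sum :: "(nat \<Rightarrow> complex \<times> real) \<Rightarrow> ennreal" where
  "radius_sum A = (\<Sum>n. ennreal (snd (A (Suc n))))"

definition classical_swiss_cheese :: "(nat \<Rightarrow> complex \<times> real) \<Rightarrow> bool" where
  "classical_swiss_cheese A \<longleftrightarrow>
     abstract_swiss_cheese A \<and> radius_sum A < \<infinity> \<and> snd (A 0) > 0 \<and>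
     (\<forall>k\<ge>1. snd (A k) > 0 \<longrightarrow>
        cball (fst (A k)) (snd (A k)) \<subseteq> ball (fst (A 0)) (snd (A 0)) \<and>
        (\<forall>l\<ge>1. snd (A l) > 0 \<and> l \<noteq> k \<longrightarrow>
           cball (fst (A k)) (snd (A k)) \<inter> cball (fst (A l)) (snd (A l)) = {}))"

text \<open>Functions on \<open>X\<close> are represented by total functions with the fixed value \<^const>\<open>undefined\<close>
  outside \<open>X\<close>, so that equality of representatives is equality on \<open>X\<close>.\<close>

definition continuous_functions :: "complex set \<Rightarrow> (complex \<Rightarrow> complex) set" where
  "continuous_functions X = {f \<in> extensional X. continuous_on X f}"

text \<open>A rational function has no poles on \<open>X\<close> iff its reduced fraction has a denominator without
  zeros on \<open>X\<close>, so it suffices to consider such fractions.\<close>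

definition rational_functions :: "complex set \<Rightarrow> (complex \<Rightarrow> complex) set" where
  "rational_functions X =
     {restrict (\<lambda>z. poly p z / poly q z) X | p q. \<forall>z\<in>X. poly q z \<noteq> 0}"

definition R :: "complex set \<Rightarrow> (complex \<Rightarrow> complex) set" where
  "R X = {f \<in> continuous_functions X.
            \<exists>g. (\<forall>n. g n \<in> rational_functions X) \<and> uniform_limit X g f sequentially}"

text \<open>Regularity on \<open>X\<close>. For \<^term>\<open>R X\<close> with \<open>X\<close> non-empty and compact this is the same as
  regularity, since all characters of \<^term>\<open>R X\<close> are evaluations at points of \<open>X\<close>.\<close>

definition regular_on :: "complex set \<Rightarrow> (complex \<Rightarrow> complex) set \<Rightarrow> bool" where
  "regular_on X F \<longleftrightarrow>
     (\<forall>E x. closedin (top_of_set X) E \<and> x \<in> X - E \<longrightarrow> (\<exists>f\<in>F. f x = 1 \<and> f ` E \<subseteq> {0}))"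

definition ext_ln :: "real \<Rightarrow> ereal" where
  "ext_ln t = (if t = 0 then -\<infinity> else ereal (ln t))"

text \<open>The integral as positive part minus negative part, where \<^const>\<open>e2ennreal\<close> maps negative
  numbers to \<open>0\<close>. It is the usual integral with values in \<open>[-\<infinity>, \<infinity>)\<close> when the positive part has
  finite integral, as is the case for \<^term>\<open>\<lambda>y. ext_ln (cmod (f y))\<close> with \<open>f\<close> bounded and a
  finite measure.\<close>

definition ext_integral :: "'a measure \<Rightarrow> ('a \<Rightarrow> ereal) \<Rightarrow> ereal" where
  "ext_integral M g =
     enn2ereal (\<integral>\<^sup>+ y. e2ennreal (g y) \<partial>M) - enn2ereal (\<integral>\<^sup>+ y. e2ennreal (- g y) \<partial>M)"

definition jensen_measure :: "complex set \<Rightarrow> complex \<Rightarrow> complex measure \<Rightarrow> bool" where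
  "jensen_measure X x \<mu> \<longleftrightarrow>
     prob_space \<mu> \<and> sets \<mu> = sets (restrict_space borel X) \<and>
     (\<forall>f\<in>R X. ext_ln (cmod (f x)) \<le> ext_integral \<mu> (\<lambda>y. ext_ln (cmod (f y))))"

text \<open>\<^term>\<open>return (restrict_space borel X) x\<close> is the point mass at \<open>x\<close> on \<open>X\<close>.\<close>

definition admits_nontrivial_jensen_measures :: "complex set \<Rightarrow> bool" where
  "admits_nontrivial_jensen_measures X \<longleftrightarrow>
     (\<exists>x\<in>X. \<exists>\<mu>. jensen_measure X x \<mu> \<and> \<mu> \<noteq> return (restrict_space borel X) x)"

end

theory Submission
  imports Defs "HOL-Complex_Analysis.Complex_Analysis" "HOL-Real_Asymp.Real_Asymp"
begin

text \<open>A disc with centre \<open>a\<close> and radius \<open>r\<close> is attached to every stage \<open>k\<close>, so that small discs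
  around each point occur infinitely often. Removing tiny discs around the poles of
  \<open>f(z) = 1 / (1 + ((z - a) / r)\<^sup>n)\<close> makes \<open>f\<close> an element of \<open>R(X)\<close> that is at least \<open>1 / 2\<close> near
  \<open>a\<close>, at most \<open>2\<^sup>1\<^sup>-\<^sup>n\<close> away from \<open>a\<close>, and bounded by a constant whose logarithm is negligible
  compared with \<open>n\<close>. Jensen's inequality for these \<open>f\<close> forces every Jensen measure to be a point
  mass; no exact cut-off functions are needed.

  The removed discs avoid the real axis and are chosen so small, relative to the distance of the
  earlier ones from the axis, that on a segment of the axis every rational function without poles on
  \<open>X\<close> differs by an extremely small amount from a function that is holomorphic and bounded on a
  strip. Thus a function in \<open>R(X)\<close> that vanishes on part of the segment vanishes on the
  whole segment, and \<open>R(X)\<close> is not regular.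

  Finally, radii can be perturbed such that each removed disc is either inside or disjoint from
  each disc of an earlier stage. The maximal discs then form a classical Swiss cheese.\<close>

subsection \<open>Roots, interval avoidance and unique continuation\<close>

lemma norm_eq_1_if_norm_power_eq_1:
  fixes w :: complex
  assumes "norm (w ^ n) = 1" "n > 0"
  shows "norm w = 1"
  using assms power_eq_imp_eq_base[of "norm w" n 1] by (simp add: norm_power)

text \<open>The powers \<open>u ^ j\<close> sum to 0, so \<open>n\<close> is the sum of the
  \<open>n\<close> differences \<open>1 - u ^ j\<close>, each of norm at most
  \<open>n * norm (1 - u)\<close>.\<close>

lemma one_le_mult_norm_root_of_unity_minus_1:
  fixes u :: complex
  assumes u: "u ^ n = 1" "u \<noteq> 1" and n: "n > 0"
  shows "1 \<le> n * norm (u - 1)"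
proof -
  have norm_u: "norm u = 1"
    using u n by (intro norm_eq_1_if_norm_power_eq_1[of u n]) auto
  have "(\<Sum>j<n. u ^ j) = 0"
    using geometric_sum[of u n] u by simp
  hence "of_nat n = (\<Sum>j<n. 1 - u ^ j)"
    by (simp add: sum_subtractf)
  hence "real n = norm (\<Sum>j<n. 1 - u ^ j)"
    by (metis norm_of_nat)
  also have "\<dots> \<le> (\<Sum>j<n. norm (1 ^ j - u ^ j))"
    by (simp add: norm_sum)
  also have "\<dots> \<le> (\<Sum>j<n. n * norm (1 - u))"
  proof (rule sum_mono)
    fix j assume "j \<in> {..<n}"
    moreover have "norm (1 ^ j - u ^ j) \<le> j * norm (1 - u)"
      by (rule norm_power_diff) (use norm_u in auto)
    ultimately show "norm (1 ^ j - u ^ j) \<le> n * norm (1 - u)"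
      by (smt (verit) lessThan_iff mult_right_mono norm_ge_zero of_nat_less_iff)
  qed
  finally have "real n * 1 \<le> real n * (n * norm (1 - u))"
    by simp
  hence "1 \<le> n * norm (1 - u)"
    using n by (subst (asm) mult_le_cancel_left_pos) auto
  thus ?thesis
    by (simp add: norm_minus_commute)
qed

text \<open>Here \<open>v / w\<close> is an \<open>n\<close>-th root of unity other than 1, and
  dividing by \<open>w\<close> keeps norms because \<open>norm w = 1\<close>.\<close>

lemma one_le_mult_norm_diff_roots:
  fixes v w :: complex
  assumes "v ^ n = - 1" "w ^ n = - 1" "v \<noteq> w" and n: "n > 0"
  shows "1 \<le> n * norm (v - w)"
proof -
  have norm_w: "norm w = 1"
    using assms by (intro norm_eq_1_if_norm_power_eq_1[of w n]) auto
  hence w0: "w \<noteq> 0" by auto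
  have "1 \<le> n * norm (v / w - 1)"
    by (rule one_le_mult_norm_root_of_unity_minus_1)
       (use assms w0 in \<open>auto simp: power_divide divide_eq_eq\<close>)
  also have "norm (v / w - 1) = norm (v - w)"
    using w0 norm_w by (simp add: diff_divide_eq_iff norm_divide field_simps flip: diff_divide_distrib)
  finally show ?thesis .
qed

text \<open>An even power of a real number is not -1, so \<open>w\<close> and \<open>cnj w\<close>
  are two different roots. This keeps the poles around a real centre off the real axis.\<close>

lemma one_le_mult_Im_root:
  fixes w :: complex
  assumes w: "w ^ n = - 1" and n: "even n" "n > 0"
  shows "1 \<le> 2 * n * \<bar>Im w\<bar>"
proof -
  have "w \<noteq> cnj w"
  proof
    assume "w = cnj w"
    hence "w = of_real (Re w)"
      by (metis Reals_cnj_iff complex_is_Real_iff of_real_Re)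
    hence "of_real (Re w ^ n) = (-1 :: complex)"
      using w by (metis of_real_power)
    hence "Re w ^ n = -1"
      by (metis of_real_1 of_real_eq_iff of_real_minus)
    thus False using n by (metis neg_0_le_iff_le not_one_le_zero zero_le_even_power)
  qed
  moreover have "cnj w ^ n = -1"
    using w by (metis complex_cnj_minus complex_cnj_one complex_cnj_power)
  ultimately have "1 \<le> n * norm (w - cnj w)"
    using one_le_mult_norm_diff_roots[of w n "cnj w"] w n by blast
  also have "norm (w - cnj w) = 2 * \<bar>Im w\<bar>"
    by (simp add: complex_diff_cnj norm_mult)
  finally show ?thesis by simp
qed

text \<open>If \<open>w\<^sup>n\<close> is close to \<open>-1\<close>, dividing \<open>w\<close> by the principal \<open>n\<close>-th root of \<open>- w\<^sup>n\<close> gives a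
  root of \<open>-1\<close> close to \<open>w\<close>.\<close>

lemma norm_one_plus_power_ge:
  fixes w :: complex
  assumes n: "n > 0" and \<tau>: "\<tau> \<le> 1"
    and far: "\<And>\<omega>. \<omega> ^ n = - 1 \<Longrightarrow> \<tau> \<le> norm (w - \<omega>)"
  shows "\<tau> / 4 \<le> norm (1 + w ^ n)"
proof (rule ccontr)
  assume "\<not> ?thesis"
  hence less: "norm (1 + w ^ n) < \<tau> / 4" by simp
  define v where "v = - (1 + w ^ n)"
  have norm_v: "norm v < \<tau> / 4"
    using less by (metis v_def norm_minus_cancel)
  have v: "norm v < 1 / 4"
    using norm_v \<tau> by simp
  have v1: "1 + v \<noteq> 0"
  proof
    assume "1 + v = 0"
    hence "v = -1" by (simp add: add_eq_0_iff)
    thus False using v by simp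
  qed
  define y where "y = Ln (1 + v) / n"
  define \<omega> where "\<omega> = w / exp y"
  have "exp y ^ n = 1 + v"
    using n v1 by (simp add: y_def flip: exp_of_nat_mult)
  hence \<omega>: "\<omega> ^ n = -1"
    using v1 by (simp add: \<omega>_def power_divide v_def divide_eq_eq)
  have "norm y = norm (Ln (1 + v)) / n"
    by (simp add: y_def norm_divide)
  also have "\<dots> \<le> norm (Ln (1 + v)) / 1"
    using n by (intro divide_left_mono) auto
  also have "\<dots> \<le> 2 * norm v"
    using norm_Ln_le[of v] v by simp
  finally have y: "norm y \<le> 2 * norm v" .
  have norm_\<omega>: "norm \<omega> = 1"
    using \<omega> n by (intro norm_eq_1_if_norm_power_eq_1[of \<omega> n]) auto
  have "w - \<omega> = \<omega> * (exp y - 1)"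
    by (simp add: \<omega>_def field_simps)
  hence "norm (w - \<omega>) = norm (exp y - 1)"
    by (simp add: norm_mult norm_\<omega>)
  also have "\<dots> \<le> 3 / 2 * norm y"
    by (rule norm_exp_bounds) (use y v in simp)
  also have "\<dots> \<le> 3 * norm v"
    using y by simp
  also have "\<dots> < \<tau>"
    using norm_v norm_ge_zero[of v] by linarith
  finally show False
    using far[OF \<omega>] by simp
qed

text \<open>By countable subadditivity of Lebesgue measure, closed intervals of total length below
  \<open>\<beta> - \<alpha>\<close> do not cover \<open>{\<alpha>..\<beta>}\<close>.\<close>

lemma exists_real_avoiding_intervals:
  fixes x :: "nat \<Rightarrow> 'a \<Rightarrow> real" and s :: "nat \<Rightarrow> real" and S :: "nat \<Rightarrow> 'a set"
  assumes S: "\<And>m. finite (S m)" and s: "\<And>m. s m \<ge> 0" and ab: "\<alpha> \<le> \<beta>"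
    and sum: "(\<Sum>m. ennreal (2 * card (S m) * s m)) < ennreal (\<beta> - \<alpha>)"
  obtains t where "\<alpha> \<le> t" "t \<le> \<beta>" "\<And>m q. q \<in> S m \<Longrightarrow> s m < \<bar>t - x m q\<bar>"
proof -
  define B where "B m = (\<Union>q\<in>S m. {x m q - s m..x m q + s m})" for m
  have B [measurable]: "B m \<in> sets lborel" for m
    unfolding B_def using S by (intro sets.finite_UN) auto
  have "emeasure lborel (B m) \<le> ennreal (2 * card (S m) * s m)" for m
  proof -
    have "emeasure lborel (B m) \<le> (\<Sum>q\<in>S m. emeasure lborel {x m q - s m..x m q + s m})"
      unfolding B_def by (rule emeasure_subadditive_finite) (use S in auto)
    also have "\<dots> = (\<Sum>q\<in>S m. ennreal (2 * s m))"
      using s by (intro sum.cong refl, subst emeasure_lborel_Icc) auto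
    also have "\<dots> = ennreal (2 * card (S m) * s m)"
      using s by (simp add: ennreal_mult'' ennreal_of_nat_eq_real_of_nat ac_simps flip: ennreal_mult)
    finally show ?thesis .
  qed
  hence "(\<Sum>m. emeasure lborel (B m)) \<le> (\<Sum>m. ennreal (2 * card (S m) * s m))"
    by (intro suminf_le) auto
  moreover have "emeasure lborel (\<Union>m. B m) \<le> (\<Sum>m. emeasure lborel (B m))"
    by (intro emeasure_subadditive_countably) (use B in blast)
  ultimately have less: "emeasure lborel (\<Union>m. B m) < emeasure lborel {\<alpha>..\<beta>}"
    using sum ab by simp
  have "\<not> {\<alpha>..\<beta>} \<subseteq> (\<Union>m. B m)"
  proof
    assume "{\<alpha>..\<beta>} \<subseteq> (\<Union>m. B m)"
    hence "emeasure lborel {\<alpha>..\<beta>} \<le> emeasure lborel (\<Union>m. B m)"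
      using B by (intro emeasure_mono sets.countable_UN) blast+
    thus False using less by simp
  qed
  then obtain t where "t \<in> {\<alpha>..\<beta>}" "t \<notin> (\<Union>m. B m)" by blast
  hence t: "\<alpha> \<le> t" "t \<le> \<beta>" "\<And>m. t \<notin> B m" by auto
  have "s m < \<bar>t - x m q\<bar>" if "q \<in> S m" for m q
    using t(3)[of m] that unfolding B_def by (force simp: abs_if)
  with t that show ?thesis by blast
qed

section \<open>Unique continuation along the real axis\<close>

definition strip :: "real \<Rightarrow> complex set" where
  "strip \<delta> = {z. \<bar>Re z\<bar> < 3 / 4 \<and> \<bar>Im z\<bar> < \<delta>}"

lemma open_strip: "open (strip \<delta>)"
proof -
  have "strip \<delta> = {z. \<bar>Re z\<bar> < 3 / 4} \<inter> {z. \<bar>Im z\<bar> < \<delta>}"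
    by (auto simp: strip_def)
  thus ?thesis
    by (auto intro!: open_Int open_Collect_less continuous_intros)
qed

lemma connected_strip: "connected (strip \<delta>)"
proof -
  have "strip \<delta> = {z. Re z < 3 / 4} \<inter> {z. Re z > - 3 / 4} \<inter> {z. Im z < \<delta>} \<inter> {z. Im z > - \<delta>}"
    by (auto simp: strip_def)
  moreover have "convex \<dots>"
    by (intro convex_Int convex_halfspace_Re_lt convex_halfspace_Re_gt
        convex_halfspace_Im_lt convex_halfspace_Im_gt)
  ultimately show ?thesis
    using convex_connected by metis
qed

definition left_segment :: "complex set" where
  "left_segment = of_real ` {- 1 / 2..0}"

text \<open>A quantitative identity theorem. One number \<open>\<delta>\<close> is both the
  half-height of the strip and the bound at \<open>1 / 2\<close>, since both shrink along the
  stages.\<close>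

definition uniqueness_gauge :: "real \<Rightarrow> real \<Rightarrow> bool" where
  "uniqueness_gauge \<delta> \<eta> \<longleftrightarrow> 0 < \<eta> \<and> (\<forall>g. g holomorphic_on strip \<delta> \<and> (\<forall>z\<in>strip \<delta>. norm (g z) \<le> 1) \<and>
     (\<forall>z\<in>left_segment. norm (g z) \<le> \<eta>) \<longrightarrow> norm (g (1 / 2)) \<le> \<delta>)"

text \<open>A compactness substitute for the two constants theorem: by Montel's theorem, a failure for
  every \<open>\<eta>\<close> would produce a holomorphic function violating the identity theorem.\<close>

lemma exists_uniqueness_gauge:
  assumes \<delta>: "\<delta> > 0"
  obtains \<eta> where "uniqueness_gauge \<delta> \<eta>"
proof (rule ccontr)
  assume "\<not> thesis"
  hence "\<not> uniqueness_gauge \<delta> (inverse (real (Suc k)))" for k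
    using that by blast
  hence "\<forall>k. \<exists>g. g holomorphic_on strip \<delta> \<and> (\<forall>z\<in>strip \<delta>. norm (g z) \<le> 1) \<and>
     (\<forall>z\<in>left_segment. norm (g z) \<le> inverse (real (Suc k))) \<and> norm (g (1 / 2)) > \<delta>"
    unfolding uniqueness_gauge_def by (auto simp: not_le)
  then obtain g where g: "\<And>k. g k holomorphic_on strip \<delta>"
      "\<And>k z. z \<in> strip \<delta> \<Longrightarrow> norm (g k z) \<le> 1"
      "\<And>k z. z \<in> left_segment \<Longrightarrow> norm (g k z) \<le> inverse (real (Suc k))"
      "\<And>k. norm (g k (1 / 2)) > \<delta>"
    by metis
  define \<H> where "\<H> = {h. h holomorphic_on strip \<delta> \<and> (\<forall>z\<in>strip \<delta>. norm (h z) \<le> 1)}"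
  obtain h \<sigma> where h: "h holomorphic_on strip \<delta>" "strict_mono (\<sigma> :: nat \<Rightarrow> nat)"
      "\<And>z. z \<in> strip \<delta> \<Longrightarrow> (\<lambda>k. g (\<sigma> k) z) \<longlonglongrightarrow> h z"
  proof (rule Montel[OF open_strip, of \<H> \<delta> g])
    fix K :: "complex set"
    assume "K \<subseteq> strip \<delta>"
    hence "\<forall>h\<in>\<H>. \<forall>z\<in>K. norm (h z) \<le> 1" by (auto simp: \<H>_def)
    thus "\<exists>B. \<forall>h\<in>\<H>. \<forall>z\<in>K. norm (h z) \<le> B" by blast
  next
    show "range g \<subseteq> \<H>" using g(1,2) by (auto simp: \<H>_def)
  qed (auto simp: \<H>_def intro: that)
  have sub: "left_segment \<subseteq> strip \<delta>" and half: "1 / 2 \<in> strip \<delta>" and 0: "0 \<in> strip \<delta>"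
    using \<delta> by (auto simp: left_segment_def strip_def)
  have zero: "h z = 0" if z: "z \<in> left_segment" for z
  proof -
    have "(\<lambda>k. g (\<sigma> k) z) \<longlonglongrightarrow> 0"
    proof (rule Lim_null_comparison)
      have "norm (g (\<sigma> k) z) \<le> inverse (real (Suc k))" for k
      proof -
        have "k \<le> \<sigma> k" using h(2) by (rule seq_suble)
        hence "inverse (real (Suc (\<sigma> k))) \<le> inverse (real (Suc k))" by (intro le_imp_inverse_le) auto
        with g(3)[OF z, of "\<sigma> k"] show ?thesis by linarith
      qed
      thus "\<forall>\<^sub>F k in sequentially. norm (g (\<sigma> k) z) \<le> inverse (real (Suc k))"
        by simp
    qed (rule LIMSEQ_inverse_real_of_nat)
    with h(3)[of z] sub z show ?thesis
      using LIMSEQ_unique by blast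
  qed
  \<comment> \<open>The identity theorem takes an accumulation point of the segment inside the
    strip; the end point 0 serves.\<close>
  have "(0::complex) islimpt left_segment"
  proof -
    have "(0::complex) islimpt of_real ` {- 1 / 2..0}"
    proof (rule islimpt_sequential[THEN iffD2], intro exI conjI allI)
      show "of_real (- inverse (real (k + 2))) \<in> of_real ` {- 1 / 2..0} - {0 :: complex}" for k
        by (auto simp del: of_real_minus of_real_inverse simp: divide_simps)
      have "(\<lambda>k. complex_of_real (- inverse (real (k + 2)))) \<longlonglongrightarrow> of_real (- 0)"
        using LIMSEQ_ignore_initial_segment[OF lim_inverse_n[where 'a = real], of 2]
        by (intro tendsto_of_real tendsto_minus) (simp add: field_simps)
      thus "(\<lambda>k. complex_of_real (- inverse (real (k + 2)))) \<longlonglongrightarrow> 0" by simp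
    qed
    thus ?thesis by (simp add: left_segment_def)
  qed
  hence "h (1 / 2) = 0"
    using analytic_continuation[OF h(1) open_strip connected_strip sub 0 _ zero half] by blast
  moreover have "\<delta> \<le> norm (h (1 / 2))"
  proof (rule tendsto_lowerbound)
    show "(\<lambda>k. norm (g (\<sigma> k) (1 / 2))) \<longlonglongrightarrow> norm (h (1 / 2))"
      by (intro tendsto_norm h(3) half)
    show "\<forall>\<^sub>F k in sequentially. \<delta> \<le> norm (g (\<sigma> k) (1 / 2))"
      using g(4) by (simp add: less_imp_le)
  qed auto
  ultimately show False using \<delta> by simp
qed

subsection \<open>The Swiss cheese\<close>

text \<open>The small ball misses the sphere of radius \<open>T\<close> about \<open>p\<close>, so
  it lies on the same side of that sphere as its centre \<open>q\<close>.\<close>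

lemma cball_inside_or_disjoint:
  fixes p q :: "'a :: metric_space"
  assumes "t < \<bar>T - dist p q\<bar>"
  shows "cball q t \<subseteq> ball p T \<or> cball q t \<inter> cball p T = {}"
proof (cases "dist p q < T")
  case True
  have "dist p z < T" if "dist q z \<le> t" for z
    using dist_triangle[of p z q] that True assms by (simp add: abs_if split: if_splits)
  thus ?thesis by (auto simp: subset_iff)
next
  case False
  have "\<not> dist p z \<le> T" if "dist q z \<le> t" for z
    using dist_triangle[of p q z] that False assms by (simp add: abs_if dist_commute split: if_splits)
  thus ?thesis by auto
qed

text \<open>Telescoping: \<open>f m \<le> g m \<le> 2 * (g m - g (Suc m))\<close>.\<close>

lemma sum_le_twice_if_halving:
  fixes f g :: "nat \<Rightarrow> real"
  assumes "\<And>m. g (Suc m) \<le> g m / 2" "\<And>m. f m \<le> g m" "\<And>m. 0 \<le> g m"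
  shows "(\<Sum>m\<in>{k..<L}. f m) \<le> 2 * g k"
proof (cases "k \<le> L")
  case True
  hence "(\<Sum>m\<in>{k..<L}. f m) \<le> 2 * g k - 2 * g L"
  proof (induction L rule: dec_induct)
    case (step m)
    thus ?case using assms(1,2)[of m] by simp
  qed simp
  thus ?thesis using assms(3)[of L] by linarith
qed (use assms(3) in auto)

text \<open>Stage \<open>k\<close> places \<open>n k\<close> poles on the circle of radius
  \<open>r k\<close> about \<open>a k\<close> and removes discs of radius between
  \<open>\<rho> k\<close> and \<open>2 * \<rho> k\<close> around them. The number
  \<open>\<delta> k\<close> is fixed before stage \<open>k\<close>: it is the half-height of a strip
  missing all earlier discs, and \<open>\<eta> k\<close> is its gauge. The bounds on
  \<open>\<delta> (Suc k)\<close> make all later stages negligible against \<open>\<rho> k\<close>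
  and \<open>\<eta> k\<close>.\<close>

locale stages =
  fixes a :: "nat \<Rightarrow> complex" and r \<rho> \<delta> \<eta> :: "nat \<Rightarrow> real" and n :: "nat \<Rightarrow> nat"
  assumes r_pos: "\<And>k. 0 < r k" and r_le_1: "\<And>k. r k \<le> 1"
    and centre: "\<And>k. Im (a k) = 0 \<or> 2 * r k \<le> \<bar>Im (a k)\<bar>"
    and n_pos: "\<And>k. 0 < n k" and n_even: "\<And>k. even (n k)"
    and \<rho>_pos: "\<And>k. 0 < \<rho> k" and \<rho>_le: "\<And>k. 8 * n k * \<rho> k \<le> r k"
    and \<delta>_0: "\<delta> 0 = 1 / 16" and \<delta>_pos: "\<And>k. 0 < \<delta> k"
    and \<delta>_Suc: "\<And>k. \<delta> (Suc k) \<le> \<delta> k / 2" "\<And>k. \<delta> (Suc k) \<le> \<rho> k / 16" "\<And>k. \<delta> (Suc k) \<le> \<eta> k / 2"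
    and mass_le: "\<And>k. 4 * (n k)\<^sup>2 * \<rho> k / r k \<le> \<delta> k" "\<And>k. 4 * (n k)\<^sup>2 * \<rho> k / r k \<le> \<eta> k"
    and gauge: "\<And>k. uniqueness_gauge (\<delta> k) (\<eta> k)"
begin

definition poles :: "nat \<Rightarrow> complex set" where
  "poles k = {p. ((p - a k) / r k) ^ n k = - 1}"

text \<open>Up to a constant, the bound for the Cauchy integrals of stage \<open>k\<close> near the
  axis per unit of sup norm: at most \<open>n k\<close> circles of radius at most
  \<open>2 * \<rho> k\<close>, at distance at least \<open>r k / (8 * n k)\<close>.\<close>

definition mass :: "nat \<Rightarrow> real" where
  "mass k = 4 * (n k)\<^sup>2 * \<rho> k / r k"

lemma
  shows finite_poles: "finite (poles k)" and card_poles: "card (poles k) = n k"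
proof -
  let ?f = "\<lambda>\<omega>. a k + of_real (r k) * \<omega>"
  have r0: "complex_of_real (r k) \<noteq> 0" using r_pos[of k] by simp
  have "poles k = ?f ` {\<omega>. \<omega> ^ n k = - 1}"
  proof safe
    fix p assume "p \<in> poles k"
    thus "p \<in> ?f ` {\<omega>. \<omega> ^ n k = - 1}"
      using r0 by (intro image_eqI[of _ _ "(p - a k) / r k"]) (auto simp: poles_def)
  qed (use r0 in \<open>auto simp: poles_def\<close>)
  moreover have "inj ?f" using r0 by (auto intro!: injI)
  ultimately show "finite (poles k)" "card (poles k) = n k"
    using finite_nth_roots[of "n k" "-1"] card_nth_roots[of "-1" "n k"] n_pos[of k]
    by (auto simp: card_image inj_on_subset)
qed

section \<open>Sums of masses and the choice of the radii\<close>

lemma mass_nonneg: "0 \<le> mass k"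
  using r_pos[of k] \<rho>_pos[of k] by (simp add: mass_def)

text \<open>Thus the decay of \<open>mass\<close> controls the sum of the radii as well as the
  Cauchy integrals.\<close>

lemma n_mult_\<rho>_le_mass: "n k * \<rho> k \<le> mass k"
proof -
  have "n k * \<rho> k * r k \<le> n k * \<rho> k * 1"
    using r_le_1[of k] \<rho>_pos[of k] by (intro mult_left_mono) auto
  also have "\<dots> \<le> n k * \<rho> k * (4 * n k)"
    using n_pos[of k] \<rho>_pos[of k] by (intro mult_left_mono) auto
  finally show ?thesis
    using r_pos[of k] by (simp add: mass_def field_simps power2_eq_square)
qed

lemma sum_mass_le_\<delta>: "(\<Sum>m\<in>{k..<L}. mass m) \<le> 2 * \<delta> k"
  using \<delta>_Suc(1) mass_le(1) \<delta>_pos unfolding mass_def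
  by (intro sum_le_twice_if_halving) (auto intro: less_imp_le)

lemma sum_mass_le_\<eta>: "(\<Sum>m\<in>{k..<L}. mass m) \<le> 2 * \<eta> k"
proof -
  have \<eta>: "0 < \<eta> k" using gauge[of k] by (simp add: uniqueness_gauge_def)
  show ?thesis
  proof (cases "k < L")
    case True
    \<comment> \<open>No decay of \<open>\<eta>\<close> is assumed, so only the first term is
      compared with \<open>\<eta> k\<close> directly; the tail goes through
      \<open>\<delta> (Suc k) \<le> \<eta> k / 2\<close>.\<close>
    hence "(\<Sum>m\<in>{k..<L}. mass m) = mass k + (\<Sum>m\<in>{Suc k..<L}. mass m)"
      by (simp add: sum.atLeast_Suc_lessThan)
    also have "\<dots> \<le> \<eta> k + 2 * \<delta> (Suc k)"
      using sum_mass_le_\<delta>[of "Suc k" L] mass_le(2)[of k] by (simp add: mass_def)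
    finally show ?thesis using \<delta>_Suc(3)[of k] by simp
  qed (use \<eta> in simp)
qed

lemma \<delta>_antimono: "k \<le> m \<Longrightarrow> \<delta> m \<le> \<delta> k"
proof (induction m rule: dec_induct)
  case (step m)
  thus ?case using \<delta>_Suc(1)[of m] \<delta>_pos[of m] by linarith
qed simp

lemma \<delta>_le_power: "\<delta> k \<le> (1 / 2) ^ k"
proof (induction k)
  case (Suc k)
  thus ?case using \<delta>_Suc(1)[of k] by simp
qed (simp add: \<delta>_0)

text \<open>Shaped as the hypothesis of \<open>exists_real_avoiding_intervals\<close>, for intervals
  of half-width \<open>2 * \<rho> m\<close> attached to the poles of all stages from
  \<open>k\<close> on.\<close>

lemma suminf_mass_le:
  "(\<Sum>m. ennreal (2 * card (if k \<le> m then poles m else {}) * (2 * \<rho> m))) \<le> ennreal (8 * \<delta> k)"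
proof (rule suminf_le_const[OF summableI])
  fix L
  let ?f = "\<lambda>m. 2 * card (if k \<le> m then poles m else {}) * (2 * \<rho> m)"
  have nonneg: "0 \<le> ?f m" for m
    using \<rho>_pos[of m] by simp
  have "(\<Sum>m<L. ?f m) \<le> (\<Sum>m<L. if k \<le> m then 4 * mass m else 0)"
    using n_mult_\<rho>_le_mass by (intro sum_mono) (auto simp: card_poles)
  also have "\<dots> = (\<Sum>m\<in>{k..<L}. 4 * mass m)"
    by (intro sum.mono_neutral_cong_right) auto
  also have "\<dots> = 4 * (\<Sum>m\<in>{k..<L}. mass m)"
    by (simp add: sum_distrib_left)
  also have "\<dots> \<le> 8 * \<delta> k"
    using sum_mass_le_\<delta>[of k L] by simp
  finally show "(\<Sum>m<L. ennreal (?f m)) \<le> ennreal (8 * \<delta> k)"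
    using nonneg by (subst sum_ennreal) (auto intro: ennreal_leI)
qed

text \<open>The intervals to avoid have total length at most
  \<open>8 * \<delta> (Suc k) \<le> \<rho> k / 2\<close>. Their half-width
  \<open>2 * \<rho> m\<close> dominates every radius allowed at stage \<open>m\<close>, so the radii
  can be chosen independently of each other.\<close>

lemma exists_radius:
  "\<exists>t. \<rho> k \<le> t \<and> t \<le> 2 * \<rho> k \<and> (\<forall>m>k. \<forall>q\<in>poles m. 2 * \<rho> m < \<bar>t - dist p q\<bar>)"
proof -
  have "8 * \<delta> (Suc k) < 2 * \<rho> k - \<rho> k"
    using \<delta>_Suc(2)[of k] \<rho>_pos[of k] by simp
  hence "(\<Sum>m. ennreal (2 * card (if Suc k \<le> m then poles m else {}) * (2 * \<rho> m)))
           < ennreal (2 * \<rho> k - \<rho> k)"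
    using suminf_mass_le[of "Suc k"] by (smt (verit) \<delta>_pos ennreal_lessI order_le_less_trans)
  then obtain t where "\<rho> k \<le> t" "t \<le> 2 * \<rho> k"
      "\<And>m q. q \<in> (if Suc k \<le> m then poles m else {}) \<Longrightarrow> 2 * \<rho> m < \<bar>t - dist p q\<bar>"
    using \<rho>_pos finite_poles
    by (elim exists_real_avoiding_intervals[where x = "\<lambda>_. dist p", rotated 3])
       (auto intro: less_imp_le)
  thus ?thesis by (intro exI[of _ t]) auto
qed

lemma exists_outer_radius:
  "\<exists>t. 1 \<le> t \<and> t \<le> 2 \<and> (\<forall>m. \<forall>q\<in>poles m. 2 * \<rho> m < \<bar>t - dist 0 q\<bar>)"
proof -
  have "8 * \<delta> 0 < 2 - 1"
    by (simp add: \<delta>_0)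
  hence "(\<Sum>m. ennreal (2 * card (if 0 \<le> m then poles m else {}) * (2 * \<rho> m)))
           < ennreal (2 - 1)"
    using suminf_mass_le[of 0] by (smt (verit) \<delta>_pos ennreal_lessI order_le_less_trans)
  then obtain t where "1 \<le> t" "t \<le> 2"
      "\<And>m q. q \<in> (if 0 \<le> m then poles m else {}) \<Longrightarrow> 2 * \<rho> m < \<bar>t - dist 0 q\<bar>"
    using \<rho>_pos finite_poles
    by (elim exists_real_avoiding_intervals[where x = "\<lambda>_. dist 0", rotated 3])
       (auto intro: less_imp_le)
  thus ?thesis by (intro exI[of _ t]) auto
qed

definition rad :: "nat \<Rightarrow> complex \<Rightarrow> real" where
  "rad k p = (SOME t. \<rho> k \<le> t \<and> t \<le> 2 * \<rho> k \<and> (\<forall>m>k. \<forall>q\<in>poles m. 2 * \<rho> m < \<bar>t - dist p q\<bar>))"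

definition outer :: real where
  "outer = (SOME t. 1 \<le> t \<and> t \<le> 2 \<and> (\<forall>m. \<forall>q\<in>poles m. 2 * \<rho> m < \<bar>t - dist 0 q\<bar>))"

lemma rad: "\<rho> k \<le> rad k p" "rad k p \<le> 2 * \<rho> k"
    and rad_avoids: "\<lbrakk>k < m; q \<in> poles m\<rbrakk> \<Longrightarrow> 2 * \<rho> m < \<bar>rad k p - dist p q\<bar>"
  using someI_ex[OF exists_radius[of k p]] unfolding rad_def by blast+

lemma outer: "1 \<le> outer" "outer \<le> 2"
    and outer_avoids: "q \<in> poles m \<Longrightarrow> 2 * \<rho> m < \<bar>outer - dist 0 q\<bar>"
  using someI_ex[OF exists_outer_radius] unfolding outer_def by blast+

lemma rad_pos: "0 < rad k p"
  using \<rho>_pos[of k] rad(1)[of k p] by linarith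

section \<open>Laminarity of the discs and their distance from the real axis\<close>

lemma laminar:
  "\<lbrakk>k < m; q \<in> poles m\<rbrakk> \<Longrightarrow>
     cball q (rad m q) \<subseteq> ball p (rad k p) \<or> cball q (rad m q) \<inter> cball p (rad k p) = {}"
  using rad(2)[of m q] rad_avoids by (intro cball_inside_or_disjoint) (meson order_le_less_trans)

lemma laminar_outer:
  "q \<in> poles m \<Longrightarrow>
     cball q (rad m q) \<subseteq> ball 0 outer \<or> cball q (rad m q) \<inter> cball 0 outer = {}"
  using rad(2)[of m q] outer_avoids by (intro cball_inside_or_disjoint) (meson order_le_less_trans)

text \<open>Two poles of one stage are scaled roots of -1, hence at distance at least
  \<open>r k / n k \<ge> 8 * \<rho> k\<close>, whereas their radii add up to at most
  \<open>4 * \<rho> k\<close>. This complements \<open>laminar\<close>, which compares different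
  stages.\<close>

lemma poles_separated:
  assumes "p \<in> poles k" "q \<in> poles k" "p \<noteq> q"
  shows "cball p (rad k p) \<inter> cball q (rad k q) = {}"
proof -
  let ?f = "\<lambda>z. (z - a k) / r k"
  have "1 \<le> n k * norm (?f p - ?f q)"
    using assms r_pos[of k] n_pos[of k] by (intro one_le_mult_norm_diff_roots) (auto simp: poles_def)
  also have "?f p - ?f q = (p - q) / r k"
    by (simp add: diff_divide_distrib)
  finally have "r k \<le> n k * dist p q"
    using r_pos[of k] by (simp add: norm_divide dist_norm field_simps)
  with \<rho>_le[of k] have "n k * (8 * \<rho> k) \<le> n k * dist p q"
    by simp
  hence "8 * \<rho> k \<le> dist p q"
    using n_pos[of k] by (subst (asm) mult_le_cancel_left_pos) auto
  hence "rad k p + rad k q < dist p q"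
    using rad(2)[of k p] rad(2)[of k q] \<rho>_pos[of k] by linarith
  thus ?thesis by (rule disjoint_cballI)
qed

text \<open>For a real centre this is the scaled bound for roots of -1; otherwise the whole circle
  of radius \<open>r k\<close> stays at distance at least \<open>r k\<close> from the axis.\<close>

lemma abs_Im_pole_ge:
  assumes "p \<in> poles k"
  shows "r k / (2 * n k) \<le> \<bar>Im p\<bar>"
proof -
  define w where "w = (p - a k) / r k"
  have w: "w ^ n k = - 1" using assms by (simp add: w_def poles_def)
  have p: "p = a k + r k * w" using r_pos[of k] by (simp add: w_def)
  from centre[of k] show ?thesis
  proof
    assume "Im (a k) = 0"
    hence "\<bar>Im p\<bar> = r k * \<bar>Im w\<bar>" using r_pos[of k] by (simp add: p abs_mult)
    moreover have "1 / (2 * n k) \<le> \<bar>Im w\<bar>"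
      using one_le_mult_Im_root[OF w n_even n_pos] n_pos[of k] by (simp add: field_simps)
    hence "r k * (1 / (2 * n k)) \<le> r k * \<bar>Im w\<bar>"
      using r_pos[of k] by (intro mult_left_mono) auto
    ultimately show ?thesis by simp
  next
    assume *: "2 * r k \<le> \<bar>Im (a k)\<bar>"
    have "norm w = 1"
      using w n_pos[of k] by (intro norm_eq_1_if_norm_power_eq_1[of w "n k"]) auto
    hence "\<bar>Im w\<bar> \<le> 1" using abs_Im_le_cmod[of w] by simp
    hence "r k * \<bar>Im w\<bar> \<le> r k * 1" using r_pos[of k] by (intro mult_left_mono) auto
    moreover have "\<bar>Im p\<bar> \<ge> \<bar>Im (a k)\<bar> - r k * \<bar>Im w\<bar>"
      using abs_triangle_ineq4[of "Im (a k) + r k * Im w" "r k * Im w"] r_pos[of k]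
      by (simp add: p abs_mult)
    ultimately have "r k \<le> \<bar>Im p\<bar>" using * by linarith
    moreover have "r k / (2 * n k) \<le> r k / 1"
      using r_pos[of k] n_pos[of k] by (intro divide_left_mono) auto
    ultimately show ?thesis by simp
  qed
qed

lemma abs_Im_disc_ge:
  assumes p: "p \<in> poles k" and w: "w \<in> cball p (rad k p)"
  shows "r k / (4 * n k) \<le> \<bar>Im w\<bar>"
proof -
  have "\<bar>Im (p - w)\<bar> \<le> norm (p - w)" by (rule abs_Im_le_cmod)
  also have "\<dots> \<le> 2 * \<rho> k" using w rad(2)[of k p] by (simp add: dist_norm)
  also have "\<dots> \<le> r k / (4 * n k)" using \<rho>_le[of k] n_pos[of k] by (simp add: field_simps)
  finally show ?thesis using abs_Im_pole_ge[OF p] by (simp add: field_simps)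
qed

text \<open>So \<open>strip (\<delta> m)\<close> reaches at most half-way from the axis to the discs
  of any stage before \<open>m\<close>.\<close>

lemma \<delta>_le_gap:
  assumes "k < m"
  shows "\<delta> m \<le> r k / (8 * n k)"
proof -
  have "\<delta> m \<le> \<delta> (Suc k)" using assms by (intro \<delta>_antimono) auto
  also have "\<dots> \<le> \<rho> k" using \<delta>_Suc(2)[of k] \<rho>_pos[of k] by simp
  also have "\<dots> \<le> r k / (8 * n k)" using \<rho>_le[of k] n_pos[of k] by (simp add: field_simps)
  finally show ?thesis .
qed

text \<open>The comparison is with all discs of earlier stages, kept or not. By
  \<open>laminar\<close> and \<open>poles_separated\<close> a disc is never inside another one of
  the same or a later stage, so the kept discs are the maximal ones.\<close>

definition kept :: "nat \<Rightarrow> complex \<Rightarrow> bool" where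
  "kept k p \<longleftrightarrow> p \<in> poles k \<and> cball p (rad k p) \<subseteq> ball 0 outer \<and>
     (\<forall>m<k. \<forall>q\<in>poles m. \<not> cball p (rad k p) \<subseteq> ball q (rad m q))"

lemma kept_disjoint:
  assumes "kept k p" "kept m q" "k \<noteq> m \<or> p \<noteq> q"
  shows "cball p (rad k p) \<inter> cball q (rad m q) = {}"
proof -
  consider "k = m" | "k < m" | "m < k" by linarith
  thus ?thesis
  proof cases
    case 1
    thus ?thesis using assms poles_separated by (auto simp: kept_def)
  next
    case 2
    thus ?thesis using assms laminar[of k m q p] by (auto simp: kept_def)
  next
    case 3
    thus ?thesis using assms laminar[of m k p q] by (auto simp: kept_def)
  qed
qed

section \<open>The compact set \<open>X\<close> and the boundary circles of the discs\<close>

definition X :: "complex set" where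
  "X = cball 0 outer - (\<Union>k. \<Union>p\<in>{p. kept k p}. ball p (rad k p))"

text \<open>Discarding discs loses nothing. Among all discs containing a given point of the outer
  disc, one of least stage is kept: it meets the outer disc, hence lies inside it, and an earlier
  disc around it would contradict minimality.\<close>

lemma X_avoids_discs:
  assumes z: "z \<in> X" and p: "p \<in> poles k"
  shows "rad k p \<le> dist p z"
proof (rule ccontr)
  assume "\<not> ?thesis"
  hence zp: "z \<in> ball p (rad k p)" by simp
  hence z': "z \<in> cball p (rad k p)" "z \<in> cball 0 outer" using z by (auto simp: X_def)
  define P where "P m \<longleftrightarrow> (\<exists>q\<in>poles m. z \<in> ball q (rad m q))" for m
  have "P k" using zp p by (auto simp: P_def)
  define m where "m = (LEAST m. P m)"
  have "P m" unfolding m_def using \<open>P k\<close> by (rule LeastI)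
  then obtain q where q: "q \<in> poles m" "z \<in> ball q (rad m q)" by (auto simp: P_def)
  have "cball q (rad m q) \<subseteq> ball 0 outer"
    using laminar_outer[OF q(1)] z'(2) subsetD[OF ball_subset_cball q(2)] by blast
  moreover have "\<not> cball q (rad m q) \<subseteq> ball q' (rad m' q')" if "m' < m" "q' \<in> poles m'" for m' q'
  proof
    assume "cball q (rad m q) \<subseteq> ball q' (rad m' q')"
    hence "P m'" using that(2) subsetD[OF ball_subset_cball q(2)] unfolding P_def by blast
    thus False using that(1) not_less_Least unfolding m_def by blast
  qed
  ultimately have "kept m q" using q(1) by (auto simp: kept_def)
  thus False using z q(2) by (auto simp: X_def)
qed

text \<open>Because the closed discs are disjoint, Cauchy integrals over their boundaries only
  involve values on \<open>X\<close>.\<close>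

lemma inner_sphere_subset_X:
  assumes "kept k p"
  shows "sphere p (rad k p) \<subseteq> X"
proof
  fix z assume z: "z \<in> sphere p (rad k p)"
  hence "z \<in> cball p (rad k p)" by auto
  moreover from this have "z \<in> ball 0 outer" using assms by (auto simp: kept_def)
  moreover have "z \<notin> ball q (rad m q)" if "kept m q" for m q
  proof (cases "m = k \<and> q = p")
    case False
    hence "cball p (rad k p) \<inter> cball q (rad m q) = {}"
      using kept_disjoint[OF assms that] by blast
    with \<open>z \<in> cball p (rad k p)\<close> show ?thesis by (auto simp: disjoint_iff dest: less_imp_le)
  qed (use z in auto)
  ultimately show "z \<in> X" by (auto simp: X_def)
qed

lemma outer_sphere_subset_X: "sphere 0 outer \<subseteq> X"
proof
  fix z :: complex
  assume z: "z \<in> sphere 0 outer"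
  have "z \<notin> ball q (rad m q)" if "kept m q" for m and q :: complex
  proof
    assume "z \<in> ball q (rad m q)"
    hence "z \<in> cball q (rad m q)" by simp
    hence "z \<in> ball 0 outer" using that unfolding kept_def by blast
    thus False using z by simp
  qed
  thus "z \<in> X" using z by (auto simp: X_def)
qed

lemma real_in_X:
  assumes "Im z = 0" "norm z \<le> 1"
  shows "z \<in> X"
proof -
  have "z \<notin> ball q (rad m q)" if "kept m q" for m and q :: complex
  proof
    assume "z \<in> ball q (rad m q)"
    hence "r m / (4 * n m) \<le> 0"
      using abs_Im_disc_ge[of q m z] assms(1) that by (auto simp: kept_def)
    thus False using r_pos[of m] n_pos[of m] by (simp add: divide_le_0_iff)
  qed
  thus ?thesis using assms outer by (auto simp: X_def)
qed

lemma compact_X: "compact X"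
  unfolding X_def by (intro compact_diff open_UN ballI) auto

section \<open>Enumeration of the kept discs as a classical Swiss cheese\<close>

definition pole :: "nat \<Rightarrow> nat \<Rightarrow> complex" where
  "pole k = (SOME h. bij_betw h {0..<n k} (poles k))"

lemma bij_betw_pole: "bij_betw (pole k) {0..<n k} (poles k)"
  using someI_ex[OF ex_bij_betw_nat_finite[OF finite_poles[of k]]]
  by (simp add: pole_def card_poles)

text \<open>Pairs that index no kept disc get radius 0: the open disc is then empty, and the
  conditions (1) and (2) of classicality concern positive radii.\<close>

definition disc :: "nat \<times> nat \<Rightarrow> complex \<times> real" where
  "disc = (\<lambda>(k, j). if j < n k \<and> kept k (pole k j) then (pole k j, rad k (pole k j)) else (0, 0))"

definition cheese :: "nat \<Rightarrow> complex \<times> real" where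
  "cheese i = (case i of 0 \<Rightarrow> (0, outer) | Suc i \<Rightarrow> disc (prod_decode i))"

lemma disc_nonneg: "0 \<le> snd (disc x)"
  using rad_pos by (auto simp: disc_def less_imp_le split: prod.splits)

lemma disc_pos:
  assumes "0 < snd (disc x)"
  obtains k j where "x = (k, j)" "j < n k" "kept k (pole k j)" "disc x = (pole k j, rad k (pole k j))"
  using assms that by (cases x) (auto simp: disc_def split: if_splits)

lemma swiss_cheese_set_cheese: "swiss_cheese_set cheese = X"
proof -
  have "(\<Union>i\<in>{1..}. ball (fst (cheese i)) (snd (cheese i)))
        = (\<Union>i. ball (fst (disc (prod_decode i))) (snd (disc (prod_decode i))))"
  proof safe
    fix z i assume "i \<ge> (1::nat)" "z \<in> ball (fst (cheese i)) (snd (cheese i))"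
    thus "z \<in> (\<Union>i. ball (fst (disc (prod_decode i))) (snd (disc (prod_decode i))))"
      by (cases i) (auto simp: cheese_def)
  next
    fix z i assume "z \<in> ball (fst (disc (prod_decode i))) (snd (disc (prod_decode i)))"
    thus "z \<in> (\<Union>i\<in>{1..}. ball (fst (cheese i)) (snd (cheese i)))"
      by (intro UN_I[of "Suc i"]) (auto simp: cheese_def)
  qed
  also have "\<dots> = (\<Union>x. ball (fst (disc x)) (snd (disc x)))"
    using surj_prod_decode by (metis (mono_tags, lifting) SUP_cong image_image)
  also have "\<dots> = (\<Union>k. \<Union>p\<in>{p. kept k p}. ball p (rad k p))"
  proof safe
    fix z x assume z: "z \<in> ball (fst (disc x)) (snd (disc x))"
    hence "0 < snd (disc x)" by (metis ball_empty empty_iff not_le)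
    then show "z \<in> (\<Union>k. \<Union>p\<in>{p. kept k p}. ball p (rad k p))"
      by (rule disc_pos) (use z in auto)
  next
    fix z k p assume z: "z \<in> ball p (rad k p)" and p: "kept k p"
    hence "p \<in> pole k ` {0..<n k}" using bij_betw_pole[of k] by (auto simp: bij_betw_def kept_def)
    then obtain j where "j < n k" "p = pole k j" by auto
    thus "z \<in> (\<Union>x. ball (fst (disc x)) (snd (disc x)))"
      using z p by (intro UN_I[of "(k, j)"]) (auto simp: disc_def)
  qed
  finally show ?thesis by (simp add: swiss_cheese_set_def X_def cheese_def)
qed

lemma radius_sum_cheese: "radius_sum cheese < \<infinity>"
proof -
  have "radius_sum cheese = (\<Sum>i. (\<lambda>x. ennreal (snd (disc x))) (prod_decode i))"
    by (simp add: radius_sum_def cheese_def)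
  also have "\<dots> = (\<Sum>k. \<Sum>j. ennreal (snd (disc (k, j))))"
    by (rule suminf_ennreal_2dimen) simp
  \<comment> \<open>The bound is twice as large as the radii require, to match
    \<open>suminf_mass_le\<close>.\<close>
  also have "\<dots> \<le> (\<Sum>k. ennreal (2 * card (if 0 \<le> k then poles k else {}) * (2 * \<rho> k)))"
  proof (rule suminf_le)
    fix k
    have "(\<Sum>j. ennreal (snd (disc (k, j)))) = (\<Sum>j<n k. ennreal (snd (disc (k, j))))"
      by (rule suminf_finite) (auto simp: disc_def)
    also have "\<dots> \<le> (\<Sum>j<n k. ennreal (2 * \<rho> k))"
      using rad(2)[of k] \<rho>_pos[of k] by (intro sum_mono ennreal_leI) (auto simp: disc_def)
    also have "\<dots> = ennreal (n k * (2 * \<rho> k))"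
      using \<rho>_pos[of k] by (simp add: ennreal_mult ennreal_of_nat_eq_real_of_nat)
    also have "\<dots> \<le> ennreal (2 * n k * (2 * \<rho> k))"
      using \<rho>_pos[of k] by (intro ennreal_leI) auto
    finally show "(\<Sum>j. ennreal (snd (disc (k, j))))
        \<le> ennreal (2 * card (if 0 \<le> k then poles k else {}) * (2 * \<rho> k))"
      by (simp add: card_poles)
  qed auto
  also have "\<dots> \<le> ennreal (8 * \<delta> 0)"
    by (rule suminf_mass_le)
  also have "\<dots> < \<infinity>" by simp
  finally show ?thesis .
qed

lemma classical_swiss_cheese_cheese: "classical_swiss_cheese cheese"
proof -
  have Suc: "cheese (Suc i) = disc (prod_decode i)" for i by (simp add: cheese_def)
  have "abstract_swiss_cheese cheese"
    using outer(1) disc_nonneg by (auto simp: abstract_swiss_cheese_def cheese_def split: nat.splits)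
  moreover have "snd (cheese 0) > 0" using outer(1) by (simp add: cheese_def)
  moreover have "cball (fst (cheese k)) (snd (cheese k)) \<subseteq> ball (fst (cheese 0)) (snd (cheese 0))"
    if k: "k \<ge> 1" "snd (cheese k) > 0" for k
  proof -
    obtain i where i: "k = Suc i" using k(1) by (cases k) auto
    with k(2) have "0 < snd (disc (prod_decode i))" by (simp add: Suc)
    thus ?thesis by (rule disc_pos) (auto simp: i Suc cheese_def kept_def)
  qed
  moreover have "cball (fst (cheese k)) (snd (cheese k)) \<inter> cball (fst (cheese l)) (snd (cheese l)) = {}"
    if kl: "k \<ge> 1" "snd (cheese k) > 0" "l \<ge> 1" "snd (cheese l) > 0" "l \<noteq> k" for k l
  proof -
    obtain i where i: "k = Suc i" using kl(1) by (cases k) auto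
    obtain i' where i': "l = Suc i'" using kl(3) by (cases l) auto
    note i = i i'
    with kl have "prod_decode i \<noteq> prod_decode i'" by simp
    moreover have pos: "0 < snd (disc (prod_decode i))" "0 < snd (disc (prod_decode i'))"
      using kl i by (simp_all add: Suc)
    from pos(1) obtain k1 j1 where 1: "prod_decode i = (k1, j1)" "j1 < n k1" "kept k1 (pole k1 j1)"
      "disc (prod_decode i) = (pole k1 j1, rad k1 (pole k1 j1))" by (rule disc_pos)
    from pos(2) obtain k2 j2 where 2: "prod_decode i' = (k2, j2)" "j2 < n k2" "kept k2 (pole k2 j2)"
      "disc (prod_decode i') = (pole k2 j2, rad k2 (pole k2 j2))" by (rule disc_pos)
    have "k1 \<noteq> k2 \<or> pole k1 j1 \<noteq> pole k2 j2"
    proof (rule ccontr)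
      assume eq: "\<not> ?thesis"
      hence "j1 = j2" using 1 2 bij_betw_pole[of k1] by (auto simp: bij_betw_def inj_on_def)
      thus False using 1 2 eq \<open>prod_decode i \<noteq> prod_decode i'\<close> by auto
    qed
    from kept_disjoint[OF 1(3) 2(3) this] show ?thesis
      using 1(4) 2(4) by (simp add: i Suc)
  qed
  ultimately show ?thesis
    using radius_sum_cheese by (auto simp: classical_swiss_cheese_def)
qed

end

subsection \<open>Jensen measures\<close>

lemma ext_ln_le:
  assumes "0 \<le> t" "t \<le> exp L"
  shows "ext_ln t \<le> ereal L"
proof (cases "t = 0")
  case False
  hence "ln t \<le> ln (exp L)" using assms by (subst ln_le_cancel_iff) auto
  thus ?thesis using False by (simp add: ext_ln_def)
qed (simp add: ext_ln_def)

lemma ext_ln_ge: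
  assumes "exp L \<le> t"
  shows "ereal L \<le> ext_ln t"
proof -
  have t: "0 < t" using assms exp_gt_zero[of L] by linarith
  hence "ln (exp L) \<le> ln t" using assms by (subst ln_le_cancel_iff) auto
  thus ?thesis using t by (simp add: ext_ln_def)
qed

text \<open>Jensen's inequality reads \<open>- c \<le> L - K * measure \<mu> E\<close>: the positive
  part of the logarithm is at most \<open>L\<close> everywhere, and its negative part is at least
  \<open>K\<close> on \<open>E\<close>.\<close>

lemma jensen_measure_bound:
  assumes \<mu>: "jensen_measure X x \<mu>" and f: "f \<in> R X" and "0 \<le> L" "0 \<le> K"
    and le_L: "\<And>y. y \<in> X \<Longrightarrow> norm (f y) \<le> exp L"
    and le_K: "\<And>y. y \<in> E \<Longrightarrow> norm (f y) \<le> exp (- K)"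
    and ge: "exp (- c) \<le> norm (f x)"
    and E: "E \<subseteq> X" "E \<in> sets \<mu>"
  shows "K * measure \<mu> E \<le> L + c"
proof -
  interpret prob_space \<mu> using \<mu> by (simp add: jensen_measure_def)
  have "sets \<mu> = sets (restrict_space borel X)" using \<mu> by (simp add: jensen_measure_def)
  hence space: "space \<mu> = X" by (metis sets_eq_imp_space_eq space_restrict_space space_borel Int_UNIV_left Int_UNIV_right)
  define P where "P = (\<integral>\<^sup>+ y. e2ennreal (ext_ln (norm (f y))) \<partial>\<mu>)"
  define N where "N = (\<integral>\<^sup>+ y. e2ennreal (- ext_ln (norm (f y))) \<partial>\<mu>)"
  have "P \<le> (\<integral>\<^sup>+ y. ennreal L \<partial>\<mu>)"
    unfolding P_def
  proof (rule nn_integral_mono)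
    fix y assume "y \<in> space \<mu>"
    hence "ext_ln (norm (f y)) \<le> ereal L"
      using le_L space by (intro ext_ln_le) auto
    thus "e2ennreal (ext_ln (norm (f y))) \<le> ennreal L"
      by (metis e2ennreal_mono e2ennreal_ereal)
  qed
  also have "\<dots> = ennreal L" by (simp add: emeasure_space_1)
  finally have P: "P \<le> ennreal L" .
  have "ennreal K * emeasure \<mu> E = (\<integral>\<^sup>+ y. ennreal K * indicator E y \<partial>\<mu>)"
    using E by (simp add: nn_integral_cmult_indicator)
  also have "\<dots> \<le> N"
    unfolding N_def
  proof (rule nn_integral_mono)
    fix y assume "y \<in> space \<mu>"
    show "ennreal K * indicator E y \<le> e2ennreal (- ext_ln (norm (f y)))"
    proof (cases "y \<in> E")
      case True
      hence "ext_ln (norm (f y)) \<le> ereal (- K)"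
        using le_K by (intro ext_ln_le) auto
      hence "ereal K \<le> - ext_ln (norm (f y))"
        by (metis ereal_minus_le_minus ereal_uminus_uminus uminus_ereal.simps(1))
      hence "ennreal K \<le> e2ennreal (- ext_ln (norm (f y)))"
        by (metis e2ennreal_mono e2ennreal_ereal)
      thus ?thesis using True by simp
    qed simp
  qed
  finally have N: "ennreal K * emeasure \<mu> E \<le> N" .
  have "ereal (- c) \<le> ext_ln (norm (f x))"
    using ge by (rule ext_ln_ge)
  also have "\<dots> \<le> ext_integral \<mu> (\<lambda>y. ext_ln (norm (f y)))"
    using \<mu> f by (simp add: jensen_measure_def)
  also have "\<dots> = enn2ereal P - enn2ereal N"
    by (simp add: ext_integral_def P_def N_def)
  also have "\<dots> \<le> enn2ereal (ennreal L) - enn2ereal (ennreal K * emeasure \<mu> E)"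
    using P N by (intro ereal_minus_mono) (auto simp: less_eq_ennreal.rep_eq)
  also have "\<dots> = ereal L - ereal (K * measure \<mu> E)"
    using \<open>0 \<le> L\<close> \<open>0 \<le> K\<close>
    by (simp add: emeasure_eq_measure enn2ereal_ennreal flip: ennreal_mult)
  finally show ?thesis by simp
qed

lemma rational_functions_subset_R: "rational_functions X \<subseteq> R X"
proof
  fix f assume f: "f \<in> rational_functions X"
  then obtain p q where pq: "f = restrict (\<lambda>z. poly p z / poly q z) X" "\<forall>z\<in>X. poly q z \<noteq> 0"
    by (auto simp: rational_functions_def)
  have "continuous_on X (\<lambda>z. poly p z / poly q z)"
    using pq(2) by (intro continuous_intros) auto
  hence "f \<in> continuous_functions X"
    by (simp add: continuous_functions_def pq(1) cong: continuous_on_cong)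
  moreover have "uniform_limit X (\<lambda>_. f) f sequentially"
    by (rule uniform_limit_const)
  ultimately show "f \<in> R X"
    using f by (auto simp: R_def intro!: exI[of _ "\<lambda>_. f"])
qed

text \<open>The set \<open>X - {x}\<close> is a countable union of null sets, namely of the points
  at distance at least \<open>1 / (j + 1)\<close> from \<open>x\<close>.\<close>

lemma prob_space_eq_return:
  assumes \<mu>: "prob_space \<mu>" "sets \<mu> = sets (restrict_space borel X)" and x: "x \<in> X"
    and null: "\<And>s. 0 < s \<Longrightarrow> measure \<mu> {z \<in> X. s \<le> dist x z} = 0"
  shows "\<mu> = return (restrict_space borel X) (x :: 'a :: metric_space)"
proof -
  interpret prob_space \<mu> by fact
  have space: "space \<mu> = X"
    using \<mu>(2) by (metis sets_eq_imp_space_eq space_restrict_space space_borel Int_UNIV_left Int_UNIV_right)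
  define E where "E j = {z \<in> X. inverse (real (Suc j)) \<le> dist x z}" for j
  have E_eq: "E j = {z. inverse (real (Suc j)) \<le> dist x z} \<inter> X" for j by (auto simp: E_def)
  have E: "E j \<in> sets \<mu>" for j
  proof -
    have "closed {z. inverse (real (Suc j)) \<le> dist x z}"
      by (intro closed_Collect_le continuous_intros)
    thus ?thesis
      unfolding E_eq \<mu>(2) sets_restrict_space by (auto simp: Int_commute intro!: imageI borel_closed)
  qed
  have "E j \<in> null_sets \<mu>" for j
    using E[of j] null[of "inverse (real (Suc j))"]
    by (intro null_setsI) (auto simp: emeasure_eq_measure E_def)
  hence "(\<Union>j. E j) \<in> null_sets \<mu>" by (intro null_sets_UN) auto
  moreover have "(\<Union>j. E j) = X - {x}"
  proof safe
    fix z assume z: "z \<in> X" "z \<notin> (\<Union>j. E j)"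
    show "z = x"
    proof (rule ccontr)
      assume "z \<noteq> x"
      then obtain j where "inverse (real (Suc j)) < dist x z"
        using reals_Archimedean[of "dist x z"] by auto
      hence "z \<in> E j" using z(1) by (simp add: E_def less_imp_le)
      thus False using z(2) by blast
    qed
  qed (auto simp: E_def)
  ultimately have null': "X - {x} \<in> null_sets \<mu>" by simp
  show ?thesis
  proof (rule measure_eqI)
    show "sets \<mu> = sets (return (restrict_space borel X) x)" by (simp add: \<mu>(2))
    fix A assume A: "A \<in> sets \<mu>"
    hence AX: "A \<subseteq> X" using sets.sets_into_space space by blast
    have "emeasure \<mu> A = indicator A x"
    proof (cases "x \<in> A")
      case True
      have "emeasure \<mu> A = emeasure \<mu> (space \<mu>)"
      proof (rule emeasure_eq_AE)
        have "AE z in \<mu>. z \<notin> X - {x}" using null' by (rule AE_not_in)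
        thus "AE z in \<mu>. z \<in> A \<longleftrightarrow> z \<in> space \<mu>"
          by eventually_elim (use True AX space in auto)
      qed (use A in auto)
      thus ?thesis using True by (simp add: emeasure_space_1)
    next
      case False
      hence "A \<subseteq> X - {x}" using AX by auto
      hence "emeasure \<mu> A = 0" using null' A by (metis null_sets_subset null_setsD1)
      thus ?thesis using False by simp
    qed
    thus "emeasure \<mu> A = emeasure (return (restrict_space borel X) x) A"
      using A \<mu>(2) by simp
  qed
qed

section \<open>Bounds for the rational bump functions\<close>

context stages
begin

definition bump :: "nat \<Rightarrow> complex \<Rightarrow> complex" where
  "bump k z = 1 / (1 + ((z - a k) / r k) ^ n k)"

text \<open>Points of \<open>X\<close> have distance at least \<open>\<rho> k\<close> from every
  pole, removed as a centre or not, so after scaling they stay \<open>\<rho> k / r k\<close> away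
  from all roots of -1.\<close>

lemma norm_bump_denominator_ge:
  assumes z: "z \<in> X"
  shows "\<rho> k / (4 * r k) \<le> norm (1 + ((z - a k) / r k) ^ n k)"
proof -
  have "\<rho> k / r k / 4 \<le> norm (1 + ((z - a k) / r k) ^ n k)"
  proof (rule norm_one_plus_power_ge)
    have "8 * 1 * \<rho> k \<le> 8 * n k * \<rho> k"
      using n_pos[of k] \<rho>_pos[of k] by (intro mult_right_mono mult_left_mono) auto
    hence "\<rho> k \<le> r k" using \<rho>_le[of k] \<rho>_pos[of k] by linarith
    thus "\<rho> k / r k \<le> 1" using r_pos[of k] by simp
  next
    fix \<omega> :: complex assume \<omega>: "\<omega> ^ n k = - 1"
    define p where "p = a k + r k * \<omega>"
    have "p \<in> poles k" using \<omega> r_pos[of k] by (simp add: p_def poles_def)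
    hence "\<rho> k \<le> dist p z" using X_avoids_discs[OF z] rad(1)[of k p] by fastforce
    also have "z - p = r k * ((z - a k) / r k - \<omega>)"
      using r_pos[of k] by (simp add: p_def field_simps)
    hence "dist p z = r k * norm ((z - a k) / r k - \<omega>)"
      using r_pos[of k] by (simp add: dist_norm norm_minus_commute[of p] norm_mult)
    finally show "\<rho> k / r k \<le> norm ((z - a k) / r k - \<omega>)"
      using r_pos[of k] by (simp add: field_simps)
  qed (rule n_pos)
  thus ?thesis by (simp add: mult.commute)
qed

lemma bump_denominator_nonzero: "z \<in> X \<Longrightarrow> 1 + ((z - a k) / r k) ^ n k \<noteq> 0"
  using norm_bump_denominator_ge[of z k] \<rho>_pos[of k] r_pos[of k]
  by (smt (verit) divide_pos_pos norm_zero)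

lemma bump_in_R: "restrict (bump k) X \<in> R X"
proof -
  define q where "q = 1 + [:- a k / r k, 1 / r k:] ^ n k"
  have q: "poly q z = 1 + ((z - a k) / r k) ^ n k" for z
    by (simp add: q_def diff_divide_distrib)
  have "restrict (bump k) X = restrict (\<lambda>z. poly 1 z / poly q z) X"
    by (simp add: q bump_def fun_eq_iff)
  moreover have "\<forall>z\<in>X. poly q z \<noteq> 0"
    using bump_denominator_nonzero by (simp add: q)
  ultimately have "restrict (bump k) X \<in> rational_functions X"
    unfolding rational_functions_def by blast
  thus ?thesis using rational_functions_subset_R by blast
qed

lemma norm_bump_le:
  assumes z: "z \<in> X"
  shows "norm (bump k z) \<le> 4 * r k / \<rho> k"
proof -
  have "norm (bump k z) \<le> 1 / (\<rho> k / (4 * r k))"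
    using norm_bump_denominator_ge[OF z, of k] \<rho>_pos[of k] r_pos[of k]
    unfolding bump_def norm_divide by (intro frac_le) auto
  thus ?thesis by simp
qed

lemma norm_bump_far:
  assumes z: "2 * r k \<le> dist (a k) z"
  shows "norm (bump k z) \<le> 2 * (1 / 2) ^ n k"
proof -
  have "2 \<le> norm ((z - a k) / r k)"
    using z r_pos[of k] by (simp add: norm_divide dist_norm norm_minus_commute field_simps)
  hence "2 ^ n k \<le> norm (((z - a k) / r k) ^ n k)"
    unfolding norm_power by (intro power_mono) auto
  moreover have "norm (((z - a k) / r k) ^ n k) - 1 \<le> norm (1 + ((z - a k) / r k) ^ n k)"
    by (metis add.commute norm_diff_ineq norm_one)
  moreover have "(2::real) ^ 1 \<le> 2 ^ n k"
    using n_pos[of k] by (intro power_increasing) auto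
  ultimately have "2 ^ n k / 2 \<le> norm (1 + ((z - a k) / r k) ^ n k)"
    by simp
  hence "norm (bump k z) \<le> 1 / (2 ^ n k / 2)"
    unfolding bump_def norm_divide by (intro frac_le) auto
  thus ?thesis by (simp add: power_one_over)
qed

lemma norm_bump_near:
  assumes z: "z \<in> X" "dist (a k) z \<le> r k / 2"
  shows "1 / 2 \<le> norm (bump k z)"
proof -
  have "norm ((z - a k) / r k) \<le> 1"
    using z(2) r_pos[of k] by (simp add: norm_divide dist_norm norm_minus_commute field_simps)
  hence "norm (((z - a k) / r k) ^ n k) \<le> 1"
    unfolding norm_power by (intro power_le_one) auto
  hence "norm (1 + ((z - a k) / r k) ^ n k) \<le> 2"
    using norm_triangle_ineq[of 1 "((z - a k) / r k) ^ n k"] by simp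
  moreover have "0 < norm (1 + ((z - a k) / r k) ^ n k)"
    using bump_denominator_nonzero[OF z(1)] by simp
  ultimately show ?thesis
    unfolding bump_def norm_divide by (simp add: field_simps)
qed

end

text \<open>By \<open>ln_bound\<close> the logarithm of the sup bound of \<open>bump k\<close> is
  negligible against \<open>n k\<close>; by \<open>dense\<close> every point is near the centres of
  arbitrarily late stages of arbitrarily small radius.\<close>

locale dense_stages = stages +
  assumes n_large: "\<And>k. k + 2 \<le> n k"
    and ln_bound: "\<And>k. ln (4 * r k / \<rho> k) \<le> n k / (real k + 1)"
    and dense: "\<And>x s k0. 0 < s \<Longrightarrow> \<exists>k\<ge>k0. dist (a k) x \<le> r k / 2 \<and> 3 * r k \<le> s"
begin

text \<open>The logarithm of the norm of \<open>bump k\<close> is at most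
  \<open>n k / (k + 1)\<close> on \<open>X\<close>, at most \<open>- (n k - 1) * ln 2\<close> on
  \<open>E\<close>, and at least \<open>- ln 2\<close> at \<open>x\<close>. Jensen's inequality
  divided by \<open>n k\<close> leaves a bound of order \<open>1 / (k + 1)\<close>.\<close>

lemma jensen_measure_stage_bound:
  assumes \<mu>: "jensen_measure X x \<mu>" and x: "x \<in> X" "dist (a k) x \<le> r k / 2"
    and E: "E \<subseteq> X" "E \<in> sets \<mu>" "\<And>z. z \<in> E \<Longrightarrow> 2 * r k \<le> dist (a k) z"
  shows "measure \<mu> E \<le> 8 / (real k + 1)"
proof -
  have "8 * 1 * \<rho> k \<le> 8 * n k * \<rho> k"
    using n_pos[of k] \<rho>_pos[of k] by (intro mult_right_mono mult_left_mono) auto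
  hence "8 * \<rho> k \<le> r k" using \<rho>_le[of k] by linarith
  hence \<rho>r: "1 \<le> 4 * r k / \<rho> k" using \<rho>_pos[of k] by (simp add: field_simps)
  let ?K = "(real (n k) - 1) * ln 2"
  have "?K * measure \<mu> E \<le> ln (4 * r k / \<rho> k) + ln 2"
  proof (rule jensen_measure_bound[OF \<mu> bump_in_R[of k] _ _ _ _ _ E(1,2)])
    show "norm (restrict (bump k) X y) \<le> exp (ln (4 * r k / \<rho> k))" if "y \<in> X" for y
      using that norm_bump_le[OF that, of k] \<rho>r by simp
    show "norm (restrict (bump k) X y) \<le> exp (- ?K)" if y: "y \<in> E" for y
    proof -
      have "norm (bump k y) \<le> 2 * (1 / 2) ^ n k" using E(3)[OF y] by (rule norm_bump_far)
      also have "\<dots> = exp (ln (2 * (1 / 2) ^ n k))" by simp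
      also have "ln (2 * (1 / 2 :: real) ^ n k) = - ?K"
        by (simp add: ln_mult ln_realpow ln_div algebra_simps)
      finally show ?thesis using y E(1) by auto
    qed
    show "exp (- ln 2) \<le> norm (restrict (bump k) X x)"
      using norm_bump_near[OF x] x(1) by (simp add: exp_minus)
  qed (use \<rho>r n_large[of k] in auto)
  also have "\<dots> \<le> n k / (real k + 1) + 1"
    using ln_bound[of k] ln_2_less_1 by linarith
  also have "\<dots> \<le> n k / (real k + 1) + n k / (real k + 1)"
    using n_large[of k] by (intro add_left_mono) (simp add: divide_simps)
  also have "\<dots> = 2 * n k / (real k + 1)"
    by simp
  finally have 1: "?K * measure \<mu> E \<le> 2 * n k / (real k + 1)" .
  \<comment> \<open>Since \<open>n k \<ge> 2\<close> and \<open>ln 2 \<ge> 1 / 2\<close>, the factor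
    \<open>?K\<close> is at least \<open>n k / 4\<close>.\<close>
  have "n k / 4 = n k / 2 * (1 / 2)" by simp
  also have "\<dots> \<le> ?K"
    using n_large[of k] ln2_ge_two_thirds by (intro mult_mono) auto
  finally have "n k / 4 * measure \<mu> E \<le> ?K * measure \<mu> E"
    by (intro mult_right_mono) auto
  with 1 have "n k * measure \<mu> E \<le> 4 * (2 * n k / (real k + 1))"
    by linarith
  also have "\<dots> = n k * (8 / (real k + 1))"
    by simp
  finally have "n k * measure \<mu> E \<le> n k * (8 / (real k + 1))" .
  thus ?thesis using n_pos[of k] by (subst (asm) mult_le_cancel_left_pos) auto
qed

lemma not_admits_nontrivial_jensen_measures: "\<not> admits_nontrivial_jensen_measures X"
proof -
  have "\<mu> = return (restrict_space borel X) x" if x: "x \<in> X" and \<mu>: "jensen_measure X x \<mu>" for x \<mu>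
  proof (rule prob_space_eq_return)
    show "prob_space \<mu>" and sets: "sets \<mu> = sets (restrict_space borel X)"
      using \<mu> by (auto simp: jensen_measure_def)
    fix s :: real assume s: "0 < s"
    define E where "E = {z \<in> X. s \<le> dist x z}"
    have "closed {z. s \<le> dist x z}"
      by (intro closed_Collect_le continuous_intros)
    moreover have "E = {z. s \<le> dist x z} \<inter> X" by (auto simp: E_def)
    ultimately have E: "E \<in> sets \<mu>"
      unfolding sets sets_restrict_space by (auto simp: Int_commute intro!: imageI borel_closed)
    have "measure \<mu> E \<le> 8 * inverse (real (Suc k0))" for k0
    proof -
      \<comment> \<open>Such a stage has \<open>x\<close> near its centre, while \<open>E\<close>
        lies beyond \<open>2 * r k\<close>, as \<open>s - r k / 2 \<ge> 2 * r k\<close>. Late stages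
        make the bound tend to 0.\<close>
      obtain k where k: "k \<ge> k0" "dist (a k) x \<le> r k / 2" "3 * r k \<le> s"
        using dense[OF s, of k0 x] by blast
      have "measure \<mu> E \<le> 8 / (real k + 1)"
      proof (rule jensen_measure_stage_bound[OF \<mu> x k(2) _ E])
        fix z assume "z \<in> E"
        hence "s \<le> dist x z" by (simp add: E_def)
        thus "2 * r k \<le> dist (a k) z"
          using dist_triangle[of x z "a k"] k(2,3) r_pos[of k] by (simp add: dist_commute)
      qed (auto simp: E_def)
      also have "\<dots> \<le> 8 / (real k0 + 1)" using k(1) by (intro divide_left_mono) auto
      finally show ?thesis by (simp add: field_simps)
    qed
    moreover have "(\<lambda>k. 8 * inverse (real (Suc k))) \<longlonglongrightarrow> 8 * 0"
      by (intro tendsto_intros LIMSEQ_inverse_real_of_nat)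
    ultimately have "measure \<mu> E \<le> 8 * 0"
      by (intro LIMSEQ_le_const) blast+
    thus "measure \<mu> {z \<in> X. s \<le> dist x z} = 0"
      using measure_nonneg[of \<mu> E] unfolding E_def by linarith
  qed (rule x)
  thus ?thesis by (auto simp: admits_nontrivial_jensen_measures_def)
qed

end

subsection \<open>Failure of regularity\<close>

definition cauchy_circle :: "(complex \<Rightarrow> complex) \<Rightarrow> complex \<Rightarrow> real \<Rightarrow> complex \<Rightarrow> complex" where
  "cauchy_circle f c t z = contour_integral (circlepath c t) (\<lambda>w. f w / (w - z)) / (2 * pi * \<i>)"

lemma
  assumes f: "continuous_on (sphere c t) f" and t: "0 < t" and z: "z \<notin> sphere c t"
  shows contour_integrable_cauchy_circle:
      "(\<lambda>w. f w / (w - z)) contour_integrable_on circlepath c t"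
    and cauchy_circle_bound: "\<lbrakk>\<And>w. w \<in> sphere c t \<Longrightarrow> norm (f w) \<le> M; 0 < e;
      \<And>w. w \<in> sphere c t \<Longrightarrow> e \<le> dist w z\<rbrakk> \<Longrightarrow> norm (cauchy_circle f c t z) \<le> t * M / e"
proof -
  have "continuous_on (path_image (circlepath c t)) (\<lambda>w. f w / (w - z))"
    using f t z by (auto intro!: continuous_intros simp: path_image_circlepath_nonneg)
  thus *: "(\<lambda>w. f w / (w - z)) contour_integrable_on circlepath c t"
    by (rule contour_integrable_continuous_circlepath)
  assume M: "\<And>w. w \<in> sphere c t \<Longrightarrow> norm (f w) \<le> M" and e: "0 < e"
    "\<And>w. w \<in> sphere c t \<Longrightarrow> e \<le> dist w z"
  have "c + of_real t \<in> sphere c t" using t by (simp add: dist_norm)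
  hence M0: "0 \<le> M" using M norm_ge_zero order_trans by blast
  have "norm (contour_integral (circlepath c t) (\<lambda>w. f w / (w - z))) \<le> M / e * (2 * pi * t)"
  proof (rule has_contour_integral_bound_circlepath[OF has_contour_integral_integral[OF *]])
    fix w assume "norm (w - c) = t"
    hence w: "w \<in> sphere c t" by (simp add: dist_norm norm_minus_commute)
    show "norm (f w / (w - z)) \<le> M / e"
      using M[OF w] e(2)[OF w] e(1) M0 by (simp add: norm_divide dist_norm frac_le)
  qed (use M0 e t in auto)
  hence "norm (contour_integral (circlepath c t) (\<lambda>w. f w / (w - z))) / (2 * pi)
      \<le> M / e * (2 * pi * t) / (2 * pi)"
    by (rule divide_right_mono) simp
  moreover have "norm (contour_integral (circlepath c t) (\<lambda>w. f w / (w - z))) / (2 * pi)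
      = norm (cauchy_circle f c t z)"
    unfolding cauchy_circle_def norm_divide by (simp add: norm_mult)
  ultimately have "norm (cauchy_circle f c t z) \<le> M / e * (2 * pi * t) / (2 * pi)"
    by simp
  also have "\<dots> = t * M / e" by simp
  finally show "norm (cauchy_circle f c t z) \<le> t * M / e" .
qed

lemma holomorphic_on_cauchy_circle:
  assumes f: "continuous_on (sphere c t) f" and t: "0 < t" and S: "S \<inter> sphere c t = {}"
  shows "cauchy_circle f c t holomorphic_on S"
proof -
  have pi: "path_image (circlepath c t) = sphere c t"
    using t by (simp add: path_image_circlepath_nonneg)
  let ?I = "\<lambda>z. contour_integral (circlepath c t) (\<lambda>w. f w / (w - z))"
  have "\<exists>d. (?I has_field_derivative d) (at z)" if z: "z \<in> S" for z
  proof -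
    \<comment> \<open>Differentiation under the integral sign for the first power of the kernel;
      \<open>B\<close> bounds the speed of the parametrised circle.\<close>
    have "(?I has_field_derivative (of_nat 1 * contour_integral (circlepath c t) (\<lambda>u. f u / (u - z) ^ Suc 1))) (at z)"
    proof (rule Cauchy_next_derivative(2)[where S = UNIV and k = 1 and B = "2 * pi * t"])
      show "norm (vector_derivative (circlepath c t) (at x)) \<le> 2 * pi * t" for x
        using t by (simp add: vector_derivative_circlepath norm_mult)
      show "((\<lambda>u. f u / (u - w) ^ 1) has_contour_integral ?I w) (circlepath c t)"
        if "w \<in> UNIV - path_image (circlepath c t)" for w
      proof -
        have "w \<notin> sphere c t" using that unfolding pi by blast
        from has_contour_integral_integral[OF contour_integrable_cauchy_circle[OF f t this]]
        show ?thesis by simp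
      qed
    qed (use f pi S z in auto)
    thus ?thesis by blast
  qed
  hence "?I holomorphic_on S"
    by (auto simp: holomorphic_on_def field_differentiable_def intro: has_field_derivative_at_within)
  thus ?thesis unfolding cauchy_circle_def by (intro holomorphic_intros) auto
qed

text \<open>The residue theorem in the plane with singular set \<open>insert z Z\<close>: the
  winding number is 1 inside the circle and 0 outside.\<close>

lemma cauchy_circle_eq_sum_residues:
  assumes Z: "finite Z" and f: "f holomorphic_on - Z" and t: "0 < t"
    and avoid: "sphere c t \<inter> insert z Z = {}"
  shows "cauchy_circle f c t z =
    (\<Sum>p\<in>insert z Z \<inter> ball c t. residue (\<lambda>w. f w / (w - z)) p)"
proof -
  let ?h = "\<lambda>w. f w / (w - z)"
  have pi: "path_image (circlepath c t) = sphere c t"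
    using t by (simp add: path_image_circlepath_nonneg)
  have "contour_integral (circlepath c t) ?h =
    2 * pi * \<i> * (\<Sum>p\<in>insert z Z. winding_number (circlepath c t) p * residue ?h p)"
  proof (rule Residue_theorem[of UNIV])
    show "?h holomorphic_on UNIV - insert z Z"
      by (intro holomorphic_intros holomorphic_on_subset[OF f]) auto
  qed (use Z avoid pi in auto)
  also have "(\<Sum>p\<in>insert z Z. winding_number (circlepath c t) p * residue ?h p) =
    (\<Sum>p\<in>insert z Z \<inter> ball c t. residue ?h p)"
  proof (rule sum.mono_neutral_cong_right)
    show "\<forall>p\<in>insert z Z - insert z Z \<inter> ball c t. winding_number (circlepath c t) p * residue ?h p = 0"
    proof
      fix p assume p: "p \<in> insert z Z - insert z Z \<inter> ball c t"
      hence "p \<notin> sphere c t" using avoid by blast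
      hence "p \<notin> cball c t" using p by (auto simp: less_le)
      hence "winding_number (circlepath c t) p = 0"
        using t by (intro winding_number_zero_outside[of _ "cball c t"]) (auto simp: pi)
      thus "winding_number (circlepath c t) p * residue ?h p = 0" by simp
    qed
    fix p assume "p \<in> insert z Z \<inter> ball c t"
    hence "winding_number (circlepath c t) p = 1"
      by (intro winding_number_circlepath) (auto simp: dist_norm norm_minus_commute)
    thus "winding_number (circlepath c t) p * residue ?h p = residue ?h p" by simp
  qed (use Z in auto)
  finally show ?thesis by (simp add: cauchy_circle_def)
qed

section \<open>Approximation on the axis by functions holomorphic in a strip\<close>

context stages
begin

definition discs :: "nat \<Rightarrow> complex set" where
  "discs k = {p. kept k p}"

lemma finite_discs: "finite (discs k)"
  by (rule finite_subset[OF _ finite_poles[of k]]) (auto simp: discs_def kept_def)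

lemma card_discs: "card (discs k) \<le> n k"
proof -
  have "card (discs k) \<le> card (poles k)"
    by (rule card_mono[OF finite_poles]) (auto simp: discs_def kept_def)
  thus ?thesis by (simp add: card_poles)
qed

text \<open>The outer circle collects the residue \<open>f z\<close> and those at all singularities
  inside it; each of these lies in exactly one kept disc, whose circle collects it again. Discs
  without singularities contribute 0, so \<open>L\<close> may be any sufficiently large
  number.\<close>

lemma cauchy_formula:
  assumes Z: "finite Z" and f: "f holomorphic_on - Z" and ZX: "Z \<inter> X = {}"
    and L: "\<And>\<zeta>. \<lbrakk>\<zeta> \<in> Z; \<zeta> \<in> ball 0 outer\<rbrakk> \<Longrightarrow> \<exists>k<L. \<exists>p\<in>discs k. \<zeta> \<in> ball p (rad k p)"
    and z: "z \<in> ball 0 outer" "z \<in> X" "\<And>k p. kept k p \<Longrightarrow> z \<notin> cball p (rad k p)"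
  shows "f z = cauchy_circle f 0 outer z - (\<Sum>k<L. \<Sum>p\<in>discs k. cauchy_circle f p (rad k p) z)"
proof -
  let ?h = "\<lambda>w. f w / (w - z)"
  define D where "D = (SIGMA k:{..<L}. discs k)"
  define B where "B = (\<lambda>(k, p). Z \<inter> ball p (rad k p))"
  have D: "finite D" unfolding D_def using finite_discs by auto
  have zZ: "z \<notin> Z" using z(2) ZX by blast
  have "cauchy_circle f 0 outer z = (\<Sum>p\<in>insert z Z \<inter> ball 0 outer. residue ?h p)"
  proof (rule cauchy_circle_eq_sum_residues[OF Z f])
    show "sphere 0 outer \<inter> insert z Z = {}"
      using outer_sphere_subset_X ZX z(1) by auto
  qed (use outer in auto)
  also have "insert z Z \<inter> ball 0 outer = insert z (Z \<inter> ball 0 outer)" using z(1) by auto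
  also have "(\<Sum>p\<in>\<dots>. residue ?h p) = residue ?h z + (\<Sum>p\<in>Z \<inter> ball 0 outer. residue ?h p)"
    using Z zZ by (subst sum.insert) auto
  also have "residue ?h z = f z"
    using Z zZ f by (intro residue_simple[of "- Z"]) (auto simp: finite_imp_closed)
  also have "Z \<inter> ball 0 outer = (\<Union>x\<in>D. B x)"
  proof
    show "Z \<inter> ball 0 outer \<subseteq> (\<Union>x\<in>D. B x)"
      using L by (force simp: D_def B_def)
    show "(\<Union>x\<in>D. B x) \<subseteq> Z \<inter> ball 0 outer"
    proof
      fix \<zeta> assume "\<zeta> \<in> (\<Union>x\<in>D. B x)"
      then obtain k p where *: "kept k p" "\<zeta> \<in> Z" "\<zeta> \<in> ball p (rad k p)"
        by (auto simp: D_def B_def discs_def)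
      hence "\<zeta> \<in> cball p (rad k p)" by simp
      thus "\<zeta> \<in> Z \<inter> ball 0 outer" using * unfolding kept_def by blast
    qed
  qed
  also have "(\<Sum>p\<in>(\<Union>x\<in>D. B x). residue ?h p) = (\<Sum>x\<in>D. \<Sum>p\<in>B x. residue ?h p)"
  proof (rule sum.UNION_disjoint)
    show "\<forall>x\<in>D. \<forall>y\<in>D. x \<noteq> y \<longrightarrow> B x \<inter> B y = {}"
    proof (intro ballI impI)
      fix x y assume xy: "x \<in> D" "y \<in> D" "x \<noteq> y"
      obtain k p m q where kp: "x = (k, p)" "y = (m, q)" by (cases x; cases y)
      have "cball p (rad k p) \<inter> cball q (rad m q) = {}"
        using xy by (intro kept_disjoint) (auto simp: kp D_def discs_def)
      hence "ball p (rad k p) \<inter> ball q (rad m q) = {}"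
        using ball_subset_cball by blast
      thus "B x \<inter> B y = {}" by (auto simp: B_def kp)
    qed
  qed (use D Z in \<open>auto simp: B_def\<close>)
  also have "\<dots> = (\<Sum>(k, p)\<in>D. cauchy_circle f p (rad k p) z)"
  proof (intro sum.cong refl, clarify)
    fix k p assume "(k, p) \<in> D"
    hence p: "kept k p" by (auto simp: D_def discs_def)
    have "cauchy_circle f p (rad k p) z = (\<Sum>p\<in>insert z Z \<inter> ball p (rad k p). residue ?h p)"
    proof (rule cauchy_circle_eq_sum_residues[OF Z f rad_pos])
      show "sphere p (rad k p) \<inter> insert z Z = {}"
        using inner_sphere_subset_X[OF p] ZX z(3)[OF p] by auto
    qed
    also have "insert z Z \<inter> ball p (rad k p) = B (k, p)"
      using z(3)[OF p] by (auto simp: B_def)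
    finally show "(\<Sum>p\<in>B (k, p). residue ?h p) = cauchy_circle f p (rad k p) z" by simp
  qed
  also have "\<dots> = (\<Sum>k<L. \<Sum>p\<in>discs k. cauchy_circle f p (rad k p) z)"
    unfolding D_def by (subst sum.Sigma) (auto simp: finite_discs)
  finally show ?thesis by simp
qed

lemma stage_sum_bound:
  assumes f: "continuous_on X f" "\<And>w. w \<in> X \<Longrightarrow> norm (f w) \<le> M"
    and z: "\<bar>Im z\<bar> \<le> r k / (8 * n k)"
  shows "norm (\<Sum>p\<in>discs k. cauchy_circle f p (rad k p) z) \<le> 4 * M * mass k"
proof -
  \<comment> \<open>Half the distance of the stage's discs from the axis; \<open>z\<close> uses up
    at most the other half.\<close>
  define e where "e = r k / (8 * n k)"
  have e: "0 < e" using r_pos[of k] n_pos[of k] by (simp add: e_def)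
  have "norm (f 0) \<le> M" by (intro f(2) real_in_X) auto
  hence M: "0 \<le> M" using norm_ge_zero order_trans by blast
  have "norm (cauchy_circle f p (rad k p) z) \<le> 2 * \<rho> k * M / e" if "p \<in> discs k" for p
  proof -
    have p: "kept k p" using that by (simp add: discs_def)
    have sub: "sphere p (rad k p) \<subseteq> X" by (rule inner_sphere_subset_X[OF p])
    have far: "e \<le> dist w z" if "w \<in> sphere p (rad k p)" for w
    proof -
      have "w \<in> cball p (rad k p)" using that by simp
      moreover have "p \<in> poles k" using p by (simp add: kept_def)
      ultimately have "r k / (4 * n k) \<le> \<bar>Im w\<bar>" by (rule abs_Im_disc_ge[rotated])
      hence "2 * e \<le> \<bar>Im w\<bar>" by (simp add: e_def)
      moreover have "\<bar>Im (w - z)\<bar> \<le> dist w z" unfolding dist_norm by (rule abs_Im_le_cmod)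
      ultimately show ?thesis using z unfolding e_def[symmetric] by simp
    qed
    have "norm (cauchy_circle f p (rad k p) z) \<le> rad k p * M / e"
    proof (rule cauchy_circle_bound[OF _ rad_pos _ _ e far])
      show "continuous_on (sphere p (rad k p)) f" using f(1) sub continuous_on_subset by blast
      show "z \<notin> sphere p (rad k p)" using far[of z] e by auto
    qed (use f(2) sub in auto)
    also have "\<dots> \<le> 2 * \<rho> k * M / e"
      using rad(2)[of k p] M e by (intro divide_right_mono mult_right_mono) auto
    finally show ?thesis .
  qed
  hence "norm (\<Sum>p\<in>discs k. cauchy_circle f p (rad k p) z) \<le> (\<Sum>p\<in>discs k. 2 * \<rho> k * M / e)"
    by (intro sum_norm_le)
  also have "\<dots> = card (discs k) * (2 * \<rho> k * M / e)" by simp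
  also have "\<dots> \<le> n k * (2 * \<rho> k * M / e)"
    using card_discs[of k] \<rho>_pos[of k] M e by (intro mult_right_mono) auto
  also have "\<dots> = 4 * M * mass k"
    using n_pos[of k] r_pos[of k] by (simp add: e_def mass_def power2_eq_square field_simps)
  finally show ?thesis .
qed

text \<open>\<open>G\<close> keeps the outer integral and those of the stages before
  \<open>N\<close>, whose circles avoid the strip. On the axis the error is the sum over the stages
  from \<open>N\<close> on, bounded by their masses.\<close>

lemma rational_approximation:
  assumes q: "q \<noteq> 0" "\<forall>w\<in>X. poly q w \<noteq> 0" and f: "f = (\<lambda>w. poly p w / poly q w)"
    and M: "\<And>w. w \<in> X \<Longrightarrow> norm (f w) \<le> M"
  obtains G where "G holomorphic_on strip (\<delta> N)" "\<And>z. z \<in> strip (\<delta> N) \<Longrightarrow> norm (G z) \<le> 17 * M"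
    "\<And>z. \<lbrakk>Im z = 0; norm z \<le> 1 / 2\<rbrakk> \<Longrightarrow> norm (f z - G z) \<le> 8 * M * min (\<delta> N) (\<eta> N)"
proof -
  define Z where "Z = {w. poly q w = 0}"
  have Z: "finite Z" using q(1) by (simp add: Z_def poly_roots_finite)
  have ZX: "Z \<inter> X = {}" using q(2) by (auto simp: Z_def)
  have hol: "f holomorphic_on - Z" unfolding f by (intro holomorphic_intros) (auto simp: Z_def)
  hence cont: "continuous_on X f"
    using ZX by (intro holomorphic_on_imp_continuous_on holomorphic_on_subset[OF hol]) auto
  have "norm (f 0) \<le> M" by (intro M real_in_X) auto
  hence M0: "0 \<le> M" using norm_ge_zero order_trans by blast
  have "\<forall>\<zeta>\<in>Z \<inter> ball 0 outer. \<exists>k. \<exists>p\<in>discs k. \<zeta> \<in> ball p (rad k p)"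
  proof
    fix \<zeta> assume \<zeta>: "\<zeta> \<in> Z \<inter> ball 0 outer"
    hence "\<zeta> \<notin> X" using ZX by blast
    thus "\<exists>k. \<exists>p\<in>discs k. \<zeta> \<in> ball p (rad k p)" using \<zeta> by (auto simp: X_def discs_def)
  qed
  then obtain K where K: "\<And>\<zeta>. \<zeta> \<in> Z \<inter> ball 0 outer \<Longrightarrow> \<exists>p\<in>discs (K \<zeta>). \<zeta> \<in> ball p (rad (K \<zeta>) p)"
    by metis
  obtain L0 where L0: "\<forall>k\<in>K ` (Z \<inter> ball 0 outer). k < L0"
    using finite_nat_bounded[of "K ` (Z \<inter> ball 0 outer)"] Z by auto
  \<comment> \<open>The maximum gives \<open>N \<le> L\<close>, so that the sum can be split at
    \<open>N\<close>.\<close>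
  define L where "L = max L0 N"
  define T where "T k z = (\<Sum>p\<in>discs k. cauchy_circle f p (rad k p) z)" for k z
  define G where "G z = cauchy_circle f 0 outer z - (\<Sum>k<N. T k z)" for z
  have far_outer: "3 / 16 \<le> dist w z" if "z \<in> strip (\<delta> N)" "w \<in> sphere 0 outer" for w z
  proof -
    have "norm z \<le> \<bar>Re z\<bar> + \<bar>Im z\<bar>" by (rule cmod_le)
    also have "\<dots> \<le> 3 / 4 + 1 / 16"
      using that(1) \<delta>_antimono[of 0 N] \<delta>_0 by (simp add: strip_def)
    finally have "norm z \<le> 13 / 16" by simp
    moreover have "norm w \<ge> 1" using that(2) outer(1) by simp
    moreover have "norm w - norm z \<le> dist w z" unfolding dist_norm by (rule norm_triangle_ineq2)
    ultimately show ?thesis by linarith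
  qed
  have outer_pos: "0 < outer" using outer(1) by simp
  have cont_outer: "continuous_on (sphere 0 outer) f"
    using cont outer_sphere_subset_X continuous_on_subset by blast
  have gap: "\<bar>Im z\<bar> \<le> r k / (8 * n k)" if "z \<in> strip (\<delta> N)" "k < N" for z k
    using that \<delta>_le_gap[of k N] by (simp add: strip_def)
  show ?thesis
  proof (rule that[of G])
    have "cauchy_circle f p (rad k p) holomorphic_on strip (\<delta> N)" if "k < N" "p \<in> discs k" for k p
    proof (rule holomorphic_on_cauchy_circle[OF _ rad_pos])
      have p: "kept k p" using that by (simp add: discs_def)
      show "continuous_on (sphere p (rad k p)) f"
        using cont inner_sphere_subset_X[OF p] continuous_on_subset by blast
      have "z \<notin> sphere p (rad k p)" if z: "z \<in> strip (\<delta> N)" for z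
      proof
        assume "z \<in> sphere p (rad k p)"
        hence "z \<in> cball p (rad k p)" by simp
        moreover have "p \<in> poles k" using p by (simp add: kept_def)
        ultimately have "r k / (4 * n k) \<le> \<bar>Im z\<bar>" by (rule abs_Im_disc_ge[rotated])
        moreover have "0 < r k / (8 * n k)" using r_pos[of k] n_pos[of k] by simp
        ultimately show False using gap[OF z \<open>k < N\<close>] by simp
      qed
      thus "strip (\<delta> N) \<inter> sphere p (rad k p) = {}" by blast
    qed
    moreover have "cauchy_circle f 0 outer holomorphic_on strip (\<delta> N)"
      by (rule holomorphic_on_cauchy_circle[OF cont_outer outer_pos]) (use far_outer in force)
    ultimately show "G holomorphic_on strip (\<delta> N)"
      unfolding G_def T_def by (intro holomorphic_intros) auto
  next
    fix z assume z: "z \<in> strip (\<delta> N)"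
    have "norm (cauchy_circle f 0 outer z) \<le> outer * M / (3 / 16)"
      by (rule cauchy_circle_bound[OF cont_outer outer_pos])
         (use far_outer[OF z] far_outer[OF z, of z] outer_sphere_subset_X M in auto)
    also have "\<dots> \<le> 2 * M / (3 / 16)"
      using outer M0 by (intro divide_right_mono mult_right_mono) auto
    finally have 1: "norm (cauchy_circle f 0 outer z) \<le> 11 * M" using M0 by simp
    have "norm (\<Sum>k<N. T k z) \<le> (\<Sum>k<N. 4 * M * mass k)"
      unfolding T_def using gap[OF z] by (intro sum_norm_le stage_sum_bound[OF cont M]) auto
    also have "\<dots> = 4 * M * (\<Sum>k\<in>{0..<N}. mass k)"
      by (simp add: sum_distrib_left lessThan_atLeast0)
    also have "\<dots> \<le> 4 * M * (2 * \<delta> 0)"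
      using M0 by (intro mult_left_mono sum_mass_le_\<delta>) auto
    finally have 2: "norm (\<Sum>k<N. T k z) \<le> M" using M0 by (simp add: \<delta>_0)
    have "norm (G z) \<le> norm (cauchy_circle f 0 outer z) + norm (\<Sum>k<N. T k z)"
      unfolding G_def by (rule norm_triangle_ineq4)
    \<comment> \<open>The bound \<open>12 * M\<close> is relaxed to the scale \<open>17 * M\<close>
      by which \<open>G\<close> is divided before the gauge is applied.\<close>
    thus "norm (G z) \<le> 17 * M" using 1 2 M0 by linarith
  next
    fix z assume z: "Im z = 0" "norm z \<le> 1 / 2"
    have "f z = cauchy_circle f 0 outer z - (\<Sum>k<L. T k z)"
      unfolding T_def
    proof (rule cauchy_formula[OF Z hol ZX])
      fix \<zeta> assume "\<zeta> \<in> Z" "\<zeta> \<in> ball 0 outer"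
      thus "\<exists>k<L. \<exists>p\<in>discs k. \<zeta> \<in> ball p (rad k p)"
        using K[of \<zeta>] L0 by (intro exI[of _ "K \<zeta>"]) (auto simp: L_def less_max_iff_disj)
    next
      show "z \<notin> cball p (rad k p)" if "kept k p" for k p
      proof
        assume "z \<in> cball p (rad k p)"
        hence "r k / (4 * n k) \<le> 0"
          using abs_Im_disc_ge[of p k z] that z(1) by (auto simp: kept_def)
        thus False using r_pos[of k] n_pos[of k] by (simp add: divide_le_0_iff)
      qed
    qed (use z outer real_in_X in auto)
    also have "(\<Sum>k<L. T k z) = (\<Sum>k<N. T k z) + (\<Sum>k\<in>{N..<L}. T k z)"
      by (subst lessThan_atLeast0, subst lessThan_atLeast0)
         (simp add: sum.atLeastLessThan_concat L_def)
    finally have "norm (f z - G z) = norm (\<Sum>k\<in>{N..<L}. T k z)"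
      by (simp add: G_def)
    also have "\<dots> \<le> (\<Sum>k\<in>{N..<L}. 4 * M * mass k)"
      unfolding T_def using z r_pos
      by (intro sum_norm_le stage_sum_bound[OF cont M]) (auto simp: less_imp_le)
    also have "\<dots> = 4 * M * (\<Sum>k\<in>{N..<L}. mass k)"
      by (simp add: sum_distrib_left)
    also have "\<dots> \<le> 4 * M * (2 * min (\<delta> N) (\<eta> N))"
      using sum_mass_le_\<delta>[of N L] sum_mass_le_\<eta>[of N L] M0 by (intro mult_left_mono) auto
    finally show "norm (f z - G z) \<le> 8 * M * min (\<delta> N) (\<eta> N)" by simp
  qed
qed

text \<open>A rational function close to an \<open>f\<close> with \<open>f (1 / 2) = 1\<close> that
  vanishes on \<open>left_segment\<close> has an approximant \<open>G\<close> that is tiny on the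
  segment. The gauge makes \<open>G\<close>, hence the rational function, small at
  \<open>1 / 2\<close>, where it should be close to 1.\<close>

lemma not_regular_on: "\<not> regular_on X (R X)"
proof
  assume reg: "regular_on X (R X)"
  have seg_real: "Im z = 0" "norm z \<le> 1 / 2" if "z \<in> left_segment" for z
    using that by (auto simp: left_segment_def)
  have "compact left_segment"
    unfolding left_segment_def by (intro compact_continuous_image continuous_intros) auto
  hence "closedin (top_of_set X) left_segment"
    using seg_real real_in_X by (intro closed_subset) (force simp: compact_imp_closed)+
  moreover have "1 / 2 \<in> X - left_segment"
    using real_in_X[of "1 / 2"] by (auto simp: left_segment_def complex_eq_iff)
  ultimately obtain f where f: "f \<in> R X" "f (1 / 2) = 1" "f ` left_segment \<subseteq> {0}"
    using reg[unfolded regular_on_def, rule_format, of left_segment "1 / 2"] by blast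
  obtain g where g: "\<And>m. g m \<in> rational_functions X" "uniform_limit X g f sequentially"
    using f(1) by (auto simp: R_def)
  have "continuous_on X f" using f(1) by (simp add: R_def continuous_functions_def)
  hence "bounded (f ` X)" by (intro compact_imp_bounded compact_continuous_image compact_X)
  then obtain B where B: "0 < B" "\<And>z. z \<in> X \<Longrightarrow> norm (f z) \<le> B"
    by (auto simp: bounded_pos)
  \<comment> \<open>\<open>M\<close> also bounds rational functions within \<open>1 / 2\<close> of
    \<open>f\<close> on \<open>X\<close>.\<close>
  define M where "M = B + 1"
  have M: "0 < M" using B by (simp add: M_def)
  \<comment> \<open>The final estimate at \<open>1 / 2\<close> is
    \<open>17 * M * \<delta> N + 8 * M * \<delta> N\<close>, which has to be below
    \<open>1 / 2\<close>. The stage is fixed first because the accuracy of the rational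
    approximation depends on \<open>\<eta> N\<close>.\<close>
  obtain N where N: "(1 / 2) ^ N < 1 / (50 * M)"
    using real_arch_pow_inv[of "1 / (50 * M)" "1 / 2"] M by auto
  have "25 * M * \<delta> N \<le> 25 * M * (1 / 2) ^ N"
    using \<delta>_le_power[of N] M by (intro mult_left_mono) auto
  also have "\<dots> < 25 * M * (1 / (50 * M))"
    using N M by (intro mult_strict_left_mono) auto
  finally have "25 * M * \<delta> N < 1 / 2" using M by simp
  have \<eta>: "0 < \<eta> N" using gauge[of N] by (simp add: uniqueness_gauge_def)
  \<comment> \<open>The second term and the error \<open>8 * M * \<eta> N\<close> of
    \<open>G\<close> add up to \<open>17 * M * \<eta> N\<close> on the segment, which is the gauge's
    threshold after scaling.\<close>
  define e where "e = min (1 / 2) (9 * M * \<eta> N)"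
  have e: "0 < e" using M \<eta> by (simp add: e_def)
  obtain m where m: "\<forall>z\<in>X. dist (g m z) (f z) < e"
    using eventually_happens'[OF sequentially_bot uniform_limitD[OF g(2) e]] by blast
  obtain p q where pq: "g m = restrict (\<lambda>z. poly p z / poly q z) X" "\<forall>z\<in>X. poly q z \<noteq> 0"
    using g(1)[of m] by (auto simp: rational_functions_def)
  define h where "h = (\<lambda>z. poly p z / poly q z)"
  have close: "norm (h z - f z) < e" if "z \<in> X" for z
    using m that by (auto simp: pq(1) h_def dist_norm)
  have "norm (h z) \<le> M" if "z \<in> X" for z
    using close[OF that] B(2)[OF that] norm_triangle_sub[of "h z" "f z"]
    by (simp add: M_def e_def)
  moreover have "q \<noteq> 0" using pq(2) real_in_X[of 0] by auto
  ultimately obtain G where G: "G holomorphic_on strip (\<delta> N)"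
      "\<And>z. z \<in> strip (\<delta> N) \<Longrightarrow> norm (G z) \<le> 17 * M"
      "\<And>z. \<lbrakk>Im z = 0; norm z \<le> 1 / 2\<rbrakk> \<Longrightarrow> norm (h z - G z) \<le> 8 * M * min (\<delta> N) (\<eta> N)"
    using rational_approximation[OF _ pq(2) h_def] by blast
  define G' where "G' z = G z / (17 * M)" for z
  have "norm (G' (1 / 2)) \<le> \<delta> N"
  proof -
    have "G' holomorphic_on strip (\<delta> N)"
      unfolding G'_def using M by (intro holomorphic_intros G(1)) auto
    moreover have "norm (G' z) \<le> 1" if "z \<in> strip (\<delta> N)" for z
      using G(2)[OF that] M by (simp add: G'_def norm_divide norm_mult)
    moreover have "norm (G' z) \<le> \<eta> N" if z: "z \<in> left_segment" for z
    proof -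
      have "z \<in> X" using seg_real[OF z] by (intro real_in_X) auto
      moreover have "f z = 0" using f(3) z by auto
      ultimately have "norm (h z) < 9 * M * \<eta> N" using close[of z] by (simp add: e_def)
      moreover have "norm (h z - G z) \<le> 8 * M * \<eta> N"
      proof -
        have "norm (h z - G z) \<le> 8 * M * min (\<delta> N) (\<eta> N)" by (intro G(3) seg_real z)
        also have "\<dots> \<le> 8 * M * \<eta> N" using M by (intro mult_left_mono) auto
        finally show ?thesis .
      qed
      ultimately have "norm (G z) \<le> 17 * M * \<eta> N"
        using norm_triangle_sub[of "G z" "h z"] by (simp add: norm_minus_commute)
      thus ?thesis using M by (simp add: G'_def norm_divide norm_mult field_simps)
    qed
    ultimately show ?thesis
      using gauge[of N] unfolding uniqueness_gauge_def by blast
  qed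
  hence "norm (G (1 / 2)) \<le> 17 * M * \<delta> N"
    using M by (simp add: G'_def norm_divide norm_mult field_simps)
  moreover have "norm (h (1 / 2) - G (1 / 2)) \<le> 8 * M * \<delta> N"
  proof -
    have "norm (h (1 / 2) - G (1 / 2)) \<le> 8 * M * min (\<delta> N) (\<eta> N)" by (intro G(3)) auto
    also have "\<dots> \<le> 8 * M * \<delta> N" using M by (intro mult_left_mono) auto
    finally show ?thesis .
  qed
  ultimately have "norm (h (1 / 2)) \<le> 25 * M * \<delta> N"
    using norm_triangle_sub[of "h (1 / 2)" "G (1 / 2)"] by simp
  moreover have "norm (h (1 / 2) - 1) < 1 / 2"
    using close[of "1 / 2"] real_in_X[of "1 / 2"] f(2) by (simp add: e_def)
  hence "1 / 2 < norm (h (1 / 2))"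
    using norm_triangle_sub[of 1 "h (1 / 2)"] by (simp add: norm_minus_commute)
  ultimately show False using \<open>25 * M * \<delta> N < 1 / 2\<close> by linarith
qed

end

subsection \<open>Choice of the parameters\<close>

text \<open>With \<open>\<rho>\<close> proportional to \<open>1 / n^2\<close> the mass does not
  depend on \<open>n\<close>, and \<open>ln (4 * r / \<rho>)\<close> grows only logarithmically in
  \<open>n\<close>, against the linear bound \<open>n / (k + 1)\<close>.\<close>

lemma exists_stage_parameters:
  fixes r \<delta> :: real and k :: nat
  assumes r: "0 < r" and \<delta>: "0 < \<delta>"
  shows "\<exists>n \<rho> \<eta>. even n \<and> k + 2 \<le> n \<and> 0 < \<rho> \<and> 8 * real n * \<rho> \<le> r \<and> uniqueness_gauge \<delta> \<eta> \<and>
    4 * (real n)\<^sup>2 * \<rho> / r \<le> \<delta> \<and> 4 * (real n)\<^sup>2 * \<rho> / r \<le> \<eta> \<and> ln (4 * r / \<rho>) \<le> real n / (real k + 1)"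
proof -
  obtain \<eta> where \<eta>: "uniqueness_gauge \<delta> \<eta>" using exists_uniqueness_gauge[OF \<delta>] .
  \<comment> \<open>The mass will be \<open>b / 2\<close>; the bound \<open>b \<le> 1\<close> yields
    \<open>8 * n * \<rho> \<le> r\<close>.\<close>
  define b where "b = min 1 (min \<delta> \<eta>)"
  have b: "0 < b" "b \<le> 1" "b \<le> \<delta>" "b \<le> \<eta>"
    using \<delta> \<eta> by (auto simp: b_def uniqueness_gauge_def)
  have "\<forall>\<^sub>F n in sequentially. ln (32 * (real n)\<^sup>2 / b) \<le> real n / (real k + 1)"
    using b(1) by real_asymp
  then obtain n0 where n0: "\<And>n. n0 \<le> n \<Longrightarrow> ln (32 * (real n)\<^sup>2 / b) \<le> real n / (real k + 1)"
    by (auto simp: eventually_sequentially)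
  define n where "n = 2 * (n0 + k + 1)"
  define \<rho> where "\<rho> = b * r / (8 * (real n)\<^sup>2)"
  have n: "even n" "k + 2 \<le> n" "n0 \<le> n" by (auto simp: n_def)
  hence n1: "1 \<le> real n" by simp
  have \<rho>: "0 < \<rho>" using b r n1 by (simp add: \<rho>_def)
  have mass: "4 * (real n)\<^sup>2 * \<rho> / r = b / 2"
    using r n1 by (simp add: \<rho>_def)
  have "8 * real n * \<rho> = b * r / real n"
    using n1 by (simp add: \<rho>_def power2_eq_square)
  also have "\<dots> \<le> 1 * r / 1"
    using b r n1 by (intro frac_le mult_right_mono) auto
  finally have "8 * real n * \<rho> \<le> r" by simp
  moreover have "4 * r / \<rho> = 32 * (real n)\<^sup>2 / b"
    using r b n1 by (simp add: \<rho>_def)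
  hence "ln (4 * r / \<rho>) \<le> real n / (real k + 1)"
    using n0[OF n(3)] by simp
  moreover have "4 * (real n)\<^sup>2 * \<rho> / r \<le> \<delta>"
    unfolding mass using b by simp
  moreover have "4 * (real n)\<^sup>2 * \<rho> / r \<le> \<eta>"
    unfolding mass using b by simp
  ultimately show ?thesis
    using n \<rho> \<eta> by blast
qed

section \<open>A dense sequence of discs\<close>

definition admissible_discs :: "(complex \<times> real) set" where
  "admissible_discs = {(a, r). 0 < r \<and> r \<le> 1 \<and> (Im a = 0 \<or> 2 * r \<le> \<bar>Im a\<bar>)}"

text \<open>Rational parameters make the family countable. A real \<open>x\<close> gets a real
  centre; otherwise \<open>r\<close> is below \<open>\<bar>Im x\<bar> / 4\<close>, so that rounding
  \<open>Im x\<close> by at most \<open>r / 4\<close> leaves a centre at least \<open>2 * r\<close>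
  off the axis.\<close>

lemma exists_rational_admissible_disc:
  fixes x :: complex
  assumes s: "0 < s"
  obtains u v r where "u \<in> \<rat>" "v \<in> \<rat>" "r \<in> \<rat>" "(Complex u v, r) \<in> admissible_discs"
    "dist (Complex u v) x \<le> r / 2" "3 * r \<le> s"
proof -
  define s' where "s' = min 1 (min (s / 3) (if Im x = 0 then 1 else \<bar>Im x\<bar> / 4))"
  have "0 < s'" using s by (simp add: s'_def)
  then obtain r where r: "r \<in> \<rat>" "0 < r" "r < s'"
    using Rats_dense_in_real by blast
  obtain u where u: "u \<in> \<rat>" "Re x - r / 4 < u" "u < Re x + r / 4"
    using Rats_dense_in_real[of "Re x - r / 4" "Re x + r / 4"] r by auto
  have "\<exists>v\<in>\<rat>. \<bar>v - Im x\<bar> \<le> r / 4 \<and> (Im x = 0 \<longrightarrow> v = 0)"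
  proof (cases "Im x = 0")
    case True
    thus ?thesis using r by (intro bexI[of _ 0]) auto
  next
    case False
    obtain v where v: "v \<in> \<rat>" "Im x - r / 4 < v" "v < Im x + r / 4"
      using Rats_dense_in_real[of "Im x - r / 4" "Im x + r / 4"] r by auto
    hence "\<bar>v - Im x\<bar> \<le> r / 4" by linarith
    thus ?thesis using False v(1) by blast
  qed
  then obtain v where v: "v \<in> \<rat>" "\<bar>v - Im x\<bar> \<le> r / 4" "Im x = 0 \<longrightarrow> v = 0" by blast
  have "dist (Complex u v) x \<le> \<bar>u - Re x\<bar> + \<bar>v - Im x\<bar>"
    using cmod_le[of "Complex u v - x"] by (simp add: dist_norm)
  also have "\<dots> \<le> r / 2" using u v by linarith
  finally have "dist (Complex u v) x \<le> r / 2" .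
  moreover have "2 * r \<le> \<bar>v\<bar>" if "Im x \<noteq> 0"
  proof -
    have "4 * r < \<bar>Im x\<bar>" using r(3) that by (simp add: s'_def)
    thus ?thesis using v(2) r(2) by linarith
  qed
  hence "(Complex u v, r) \<in> admissible_discs"
    using r v by (auto simp: admissible_discs_def s'_def split: if_splits)
  ultimately show ?thesis
    using that u(1) v(1) r by (auto simp: s'_def)
qed

lemma exists_dense_disc_sequence:
  obtains a :: "nat \<Rightarrow> complex" and r :: "nat \<Rightarrow> real" where "\<And>k. (a k, r k) \<in> admissible_discs"
    "\<And>x s k0. 0 < s \<Longrightarrow> \<exists>k\<ge>k0. dist (a k) x \<le> r k / 2 \<and> 3 * r k \<le> s"
proof -
  define F where "F = admissible_discs \<inter> (\<lambda>(u, v, r). (Complex u v, r)) ` (\<rat> \<times> \<rat> \<times> \<rat>)"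
  have F: "countable F" unfolding F_def by (intro countable_Int2 countable_image countable_SIGMA countable_rat)
  have dense: "\<exists>(a, r)\<in>F. dist a x \<le> r / 2 \<and> 3 * r \<le> s" if s: "0 < s" for x s
  proof -
    obtain u v r where "u \<in> \<rat>" "v \<in> \<rat>" "r \<in> \<rat>" "(Complex u v, r) \<in> admissible_discs"
      "dist (Complex u v) x \<le> r / 2" "3 * r \<le> s"
      using exists_rational_admissible_disc[OF s] by metis
    thus ?thesis
      by (intro bexI[of _ "(Complex u v, r)"]) (auto simp: F_def image_iff)
  qed
  have "F \<noteq> {}" using dense[of 1 0] by auto
  then obtain e :: "nat \<Rightarrow> complex \<times> real" where e: "range e = F"
    using F range_from_nat_into by metis
  \<comment> \<open>Using only the first component of the pair repeats each disc infinitely often,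
    hence also beyond any \<open>k0\<close>.\<close>
  define a where "a k = fst (e (fst (prod_decode k)))" for k
  define r where "r k = snd (e (fst (prod_decode k)))" for k
  show ?thesis
  proof (rule that[of a r])
    have "e i \<in> F" for i using e by blast
    thus "(a k, r k) \<in> admissible_discs" for k by (simp add: a_def r_def F_def)
  next
    fix x :: complex and s :: real and k0
    assume "0 < s"
    then obtain b t where bt: "(b, t) \<in> F" "dist b x \<le> t / 2" "3 * t \<le> s" using dense by blast
    then obtain i where i: "e i = (b, t)" using e by (metis imageE)
    show "\<exists>k\<ge>k0. dist (a k) x \<le> r k / 2 \<and> 3 * r k \<le> s"
      using bt i le_prod_encode_2[of k0 i]
      by (intro exI[of _ "prod_encode (i, k0)"]) (auto simp: a_def r_def)
  qed
qed

lemma exists_dense_stages: "\<exists>a r \<rho> \<delta> \<eta> n. dense_stages a r \<rho> \<delta> \<eta> n"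
proof -
  obtain a :: "nat \<Rightarrow> complex" and r where ar: "\<And>k. (a k, r k) \<in> admissible_discs"
    and dense: "\<And>x s k0. 0 < s \<Longrightarrow> \<exists>k\<ge>k0. dist (a k) x \<le> r k / 2 \<and> 3 * r k \<le> s"
    using exists_dense_disc_sequence by metis
  have r: "0 < r k" "r k \<le> 1" "Im (a k) = 0 \<or> 2 * r k \<le> \<bar>Im (a k)\<bar>" for k
    using ar[of k] by (auto simp: admissible_discs_def)
  \<comment> \<open>Choosing the parameters as functions of the stage and an arbitrary
    \<open>\<delta>\<close> leaves a recursion for \<open>\<delta>\<close> alone.\<close>
  have "\<forall>k. \<forall>\<delta>. \<exists>n \<rho> \<eta>. 0 < \<delta> \<longrightarrow>
    even n \<and> k + 2 \<le> n \<and> 0 < \<rho> \<and> 8 * real n * \<rho> \<le> r k \<and> uniqueness_gauge \<delta> \<eta> \<and>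
    4 * (real n)\<^sup>2 * \<rho> / r k \<le> \<delta> \<and> 4 * (real n)\<^sup>2 * \<rho> / r k \<le> \<eta> \<and> ln (4 * r k / \<rho>) \<le> real n / (real k + 1)"
    using exists_stage_parameters[OF r(1)] by metis
  then obtain n' :: "nat \<Rightarrow> real \<Rightarrow> nat" and \<rho>' \<eta>' :: "nat \<Rightarrow> real \<Rightarrow> real" where
    *: "\<And>k \<delta>. 0 < \<delta> \<Longrightarrow> even (n' k \<delta>) \<and> k + 2 \<le> n' k \<delta> \<and> 0 < \<rho>' k \<delta> \<and>
      8 * real (n' k \<delta>) * \<rho>' k \<delta> \<le> r k \<and> uniqueness_gauge \<delta> (\<eta>' k \<delta>) \<and>
      4 * (real (n' k \<delta>))\<^sup>2 * \<rho>' k \<delta> / r k \<le> \<delta> \<and> 4 * (real (n' k \<delta>))\<^sup>2 * \<rho>' k \<delta> / r k \<le> \<eta>' k \<delta> \<and>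
      ln (4 * r k / \<rho>' k \<delta>) \<le> real (n' k \<delta>) / (real k + 1)"
    by metis
  define \<delta> where "\<delta> = rec_nat (1 / 16) (\<lambda>k d. min (d / 2) (min (\<rho>' k d / 16) (\<eta>' k d / 2)))"
  have \<delta>: "\<delta> 0 = 1 / 16"
      "\<delta> (Suc k) = min (\<delta> k / 2) (min (\<rho>' k (\<delta> k) / 16) (\<eta>' k (\<delta> k) / 2))" for k
    by (simp_all add: \<delta>_def)
  have \<delta>_pos: "0 < \<delta> k" for k
  proof (induction k)
    case (Suc k)
    with *[OF Suc] show ?case by (simp add: \<delta> uniqueness_gauge_def)
  qed (simp add: \<delta>)
  note ** = *[OF \<delta>_pos]
  have "dense_stages a r (\<lambda>k. \<rho>' k (\<delta> k)) \<delta> (\<lambda>k. \<eta>' k (\<delta> k)) (\<lambda>k. n' k (\<delta> k))"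
  proof
    show "0 < n' k (\<delta> k)" for k using **[of k k] by auto
  qed (use r ** \<delta> \<delta>_pos dense in auto)
  thus ?thesis by blast
qed

theorem theorem4p5:
  shows "\<exists>A :: nat \<Rightarrow> complex \<times> real.
    classical_swiss_cheese A \<and>
    \<not> regular_on (swiss_cheese_set A) (R (swiss_cheese_set A)) \<and>
    \<not> admits_nontrivial_jensen_measures (swiss_cheese_set A)"
proof -
  obtain a r \<rho> \<delta> \<eta> n where "dense_stages a r \<rho> \<delta> \<eta> n"
    using exists_dense_stages by blast
  then interpret dense_stages a r \<rho> \<delta> \<eta> n .
  show ?thesis
    using classical_swiss_cheese_cheese not_regular_on not_admits_nontrivial_jensen_measures
    by (intro exI[of _ cheese]) (simp add: swiss_cheese_set_cheese)
qed

end
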